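(* Let $\mathbf M$ be a flag matroid (equivalently, a flag $\mathbb K$-matroid) of rank $(r,r+1)$ on $E=\{1,\dots,n\}$. Then $\mathbf M$ is regular if and only if it is binary and orientable.
   Context: A tract is a commutative multiplicative monoid $F$ with identity $1$ and absorbing element $0$ such that $F^\times=F\setminus\{0\}$ is a group, together with a subset $N_F\subseteq\mathbb{N}[F^\times]$ (the nullset) such that $0\in N_F$, $1\notin N_F$, there is a unique $\epsilon\in F^\times$ with $1+\epsilon\in N_F$, and $N_F$ is stable under multiplication by $F^\times$. A tract morphism $f:F\to F'$ is multiplicative with $f(0)=0$, $f(1)=1$, $\sum f(a_i)\in N_{F'}$ whenever $\sum a_i\in N_F$. Examples: the Krasner hyperfield $\mathbb K=\{0,1\}$ with $N_{\mathbb K}=\mathbb N\setminus\{1\}$; the regular partial field $\mathbb F_1^\pm=\{0,1,\epsilon\}$ with $N=\{m\cdot1+m\cdot\epsilon: m\in\mathbb N\}$; the field $\mathbb F_2$ with $N=\{\sum a_i: \sum a_i=0\text{ in }\mathbb F_2\}$; the sign hyperfield $\mathbb S=\{0,1,-1\}$ with $\epsilon=-1$ and $N_{\mathbb S}=\{m\cdot1+m'\cdot(-1): m=m'=0\text{ or }m\neq0\neq m'\}$. For each tract $F$ there is a unique tract morphism $t_F:F\to\mathbb K$ (sending $F^\times$ to $1$). A Grassmann–Plücker function of rank $r$ on $E$ is a map $\varphi:E^r\to F$, not identically zero, alternating (swapping two arguments multiplies by $\epsilon$; $0$ if two arguments coincide), with $\sum_{k=1}^{r+1}\epsilon^k\varphi(y_1,\dots,\widehat{y_k},\dots,y_{r+1})\varphi(y_k,x_1,\dots,x_{r-1})\in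 N_F$ for all $x_i,y_j\in E$. An $F$-matroid is a class $[\varphi]$ modulo $F^\times$; push-forward $f_*[\varphi]=[f\circ\varphi]$. If $M=[\mu]$, $N=[\nu]$ have ranks $r,w$, then $N\twoheadrightarrow M$ means $\sum_{k=1}^{w+1}\epsilon^k\nu(y_1,\dots,\widehat{y_k},\dots,y_{w+1})\mu(y_k,x_1,\dots,x_{r-1})\in N_F$ for all indices. A flag $F$-matroid is a sequence $(M_1,\dots,M_s)$ with $M_j\twoheadrightarrow M_i$ for $i<j$, of rank $(\mathrm{rk}M_1,\dots,\mathrm{rk}M_s)$; $f_*(M_1,\dots,M_s)=(f_*M_1,\dots,f_*M_s)$. Usual flag matroids (sequences of matroids each a quotient of the next, i.e. flats of $M_i$ are flats of $M_{i+1}$) are identified with flag $\mathbb K$-matroids by taking underlying matroids. A flag matroid $\mathbf M$ is regular if $\mathbf M=t_{\mathbb F_1^\pm,*}\mathbf N$ for some flag $\mathbb F_1^\pm$-matroid $\mathbf N$; binary if $\mathbf M=t_{\mathbb F_2,*}\mathbf N$ for some flag $\mathbb F_2$-matroid $\mathbf N$; orientable if $\mathbf M=t_{\mathbb S,*}\mathbf N$ for some flag $\mathbb S$-matroid $\mathbf N$. *)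

theory Defs
  imports "HOL-Algebra.Group" "HOL-Library.Multiset" "HOL-Library.FuncSet" "HOL-Library.Z2"
begin

section \<open>Tracts\<close>

text \<open>Elements of \<open>\<nat>[F\<^sup>\<times>]\<close> are encoded as multisets of units of \<open>F\<close>.\<close>

record 'a tract_data = "'a monoid" +
  tzero :: 'a
  nullset :: "'a multiset set"

locale tract = comm_monoid F for F :: "('a, 'b) tract_data_scheme" (structure) +
  assumes zero_closed: "tzero F \<in> carrier F"
    and zero_absorbing: "a \<in> carrier F \<Longrightarrow> tzero F \<otimes> a = tzero F"
    and Units_eq: "Units F = carrier F - {tzero F}"
    and nullset_Units: "S \<in> nullset F \<Longrightarrow> set_mset S \<subseteq> Units F"
    and empty_nullset: "{#} \<in> nullset F"
    and one_not_nullset: "{#\<one>#} \<notin> nullset F"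
    and unique_eps: "\<exists>!e. e \<in> Units F \<and> {#\<one>, e#} \<in> nullset F"
    and nullset_stable: "a \<in> Units F \<Longrightarrow> S \<in> nullset F \<Longrightarrow> {# a \<otimes> b. b \<in># S #} \<in> nullset F"

definition eps :: "('a, 'b) tract_data_scheme \<Rightarrow> 'a" where
  "eps F = (THE e. e \<in> Units F \<and> {#\<one>\<^bsub>F\<^esub>, e#} \<in> nullset F)"

definition tract_hom :: "('a, 'c) tract_data_scheme \<Rightarrow> ('b, 'd) tract_data_scheme \<Rightarrow> ('a \<Rightarrow> 'b) set" where
  "tract_hom F F' = {f \<in> hom F F'. f (tzero F) = tzero F' \<and> f \<one>\<^bsub>F\<^esub> = \<one>\<^bsub>F'\<^esub> \<and>
     (\<forall>S \<in> nullset F. image_mset f S \<in> nullset F')}"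

text \<open>A formal sum of arbitrary elements of \<open>F\<close> lies in \<open>\<nat>[F\<^sup>\<times>]\<close> after its zero terms,
  which do not contribute, have been deleted.\<close>

definition null_sum :: "('a, 'b) tract_data_scheme \<Rightarrow> 'a multiset \<Rightarrow> bool" where
  "null_sum F S \<longleftrightarrow> {# a \<in># S. a \<noteq> tzero F #} \<in> nullset F"

definition krasner :: "nat tract_data" where
  "krasner = \<lparr>carrier = {0, 1}, monoid.mult = (*), one = 1, tzero = 0,
     nullset = {replicate_mset m 1 | m. m \<noteq> 1}\<rparr>"

definition F1pm :: "int tract_data" where
  "F1pm = \<lparr>carrier = {0, 1, -1}, monoid.mult = (*), one = 1, tzero = 0,
     nullset = {replicate_mset m 1 + replicate_mset m (-1) | m. True}\<rparr>"

definition F2 :: "bit tract_data" where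
  "F2 = \<lparr>carrier = UNIV, monoid.mult = (*), one = 1, tzero = 0,
     nullset = {S. 0 \<notin># S \<and> sum_mset S = 0}\<rparr>"

definition sign_hyperfield :: "int tract_data" where
  "sign_hyperfield = \<lparr>carrier = {0, 1, -1}, monoid.mult = (*), one = 1, tzero = 0,
     nullset = {replicate_mset m 1 + replicate_mset m' (-1) | m m'.
       (m = 0 \<and> m' = 0) \<or> (m \<noteq> 0 \<and> m' \<noteq> 0)}\<rparr>"

definition to_krasner :: "('a, 'b) tract_data_scheme \<Rightarrow> 'a \<Rightarrow> nat" where
  "to_krasner F a = (if a = tzero F then 0 else 1)"


section \<open>Matroids and flag matroids with coefficients\<close>

definition tuples :: "'e set \<Rightarrow> nat \<Rightarrow> 'e list set" where
  "tuples E r = {xs. length xs = r \<and> set xs \<subseteq> E}"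

text \<open>The relations \<open>\<Sum>\<^sub>k \<epsilon>\<^sup>k \<nu>(y\<^sub>1, \<dots>, y\<^sub>k omitted, \<dots>, y\<^sub>w\<^sub>+\<^sub>1) \<mu>(y\<^sub>k, x\<^sub>1, \<dots>, x\<^sub>r\<^sub>-\<^sub>1) \<in> N\<^sub>F\<close>.
  Positions are counted from \<open>0\<close>, hence the exponent \<open>Suc k\<close>. The condition on the length of \<open>xs\<close>
  makes the relations vacuous for \<open>r = 0\<close>, where there are no tuples \<open>(x\<^sub>1, \<dots>, x\<^sub>r\<^sub>-\<^sub>1)\<close>.\<close>

definition pluecker_relations ::
    "('a, 'b) tract_data_scheme \<Rightarrow> 'e set \<Rightarrow> nat \<Rightarrow> ('e list \<Rightarrow> 'a) \<Rightarrow> nat \<Rightarrow> ('e list \<Rightarrow> 'a) \<Rightarrow> bool" where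
  "pluecker_relations F E w \<nu> r \<mu> \<longleftrightarrow>
     (\<forall>ys \<in> tuples E (Suc w). \<forall>xs. set xs \<subseteq> E \<and> Suc (length xs) = r \<longrightarrow>
       null_sum F {# eps F [^]\<^bsub>F\<^esub> Suc k \<otimes>\<^bsub>F\<^esub> \<nu> (take k ys @ drop (Suc k) ys) \<otimes>\<^bsub>F\<^esub> \<mu> (ys ! k # xs).
                     k \<in># mset_set {0..w} #})"

definition gp_functions :: "('a, 'b) tract_data_scheme \<Rightarrow> 'e set \<Rightarrow> nat \<Rightarrow> ('e list \<Rightarrow> 'a) set" where
  "gp_functions F E r = {\<phi> \<in> tuples E r \<rightarrow>\<^sub>E carrier F.
     (\<exists>xs \<in> tuples E r. \<phi> xs \<noteq> tzero F) \<and>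
     (\<forall>xs \<in> tuples E r. \<forall>i j. i < j \<and> j < r \<longrightarrow>
        \<phi> (xs[i := xs ! j, j := xs ! i]) = eps F \<otimes>\<^bsub>F\<^esub> \<phi> xs \<and>
        (xs ! i = xs ! j \<longrightarrow> \<phi> xs = tzero F)) \<and>
     pluecker_relations F E r \<phi> r \<phi>}"

definition gp_class ::
    "('a, 'b) tract_data_scheme \<Rightarrow> 'e set \<Rightarrow> nat \<Rightarrow> ('e list \<Rightarrow> 'a) \<Rightarrow> ('e list \<Rightarrow> 'a) set" where
  "gp_class F E r \<phi> = {\<lambda>xs\<in>tuples E r. a \<otimes>\<^bsub>F\<^esub> \<phi> xs | a. a \<in> Units F}"

text \<open>A matroid with coefficients is a class of Grassmann--Pluecker functions, stored together with
  its rank.\<close>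

record ('e, 'a) coeff_matroid =
  mrank :: nat
  mclass :: "('e list \<Rightarrow> 'a) set"

definition coeff_matroids :: "('a, 'b) tract_data_scheme \<Rightarrow> 'e set \<Rightarrow> ('e, 'a) coeff_matroid set" where
  "coeff_matroids F E = {\<lparr>mrank = r, mclass = gp_class F E r \<phi>\<rparr> | r \<phi>. \<phi> \<in> gp_functions F E r}"

definition matroid_quotient ::
    "('a, 'b) tract_data_scheme \<Rightarrow> 'e set \<Rightarrow> ('e, 'a) coeff_matroid \<Rightarrow> ('e, 'a) coeff_matroid \<Rightarrow> bool" where
  "matroid_quotient F E N M \<longleftrightarrow>
     (\<forall>\<nu> \<in> mclass N. \<forall>\<mu> \<in> mclass M. pluecker_relations F E (mrank N) \<nu> (mrank M) \<mu>)"

definition push_forward ::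
    "('b, 'd) tract_data_scheme \<Rightarrow> 'e set \<Rightarrow> ('a \<Rightarrow> 'b) \<Rightarrow> ('e, 'a) coeff_matroid \<Rightarrow> ('e, 'b) coeff_matroid" where
  "push_forward F' E f M =
     \<lparr>mrank = mrank M, mclass = (\<Union>\<phi> \<in> mclass M. gp_class F' E (mrank M) (f \<circ> \<phi>))\<rparr>"

definition flag_matroid :: "('a, 'b) tract_data_scheme \<Rightarrow> 'e set \<Rightarrow> ('e, 'a) coeff_matroid list \<Rightarrow> bool" where
  "flag_matroid F E Ms \<longleftrightarrow> set Ms \<subseteq> coeff_matroids F E \<and>
     (\<forall>i j. i < j \<and> j < length Ms \<longrightarrow> matroid_quotient F E (Ms ! j) (Ms ! i))"

definition flag_rank :: "('e, 'a) coeff_matroid list \<Rightarrow> nat list" where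
  "flag_rank Ms = map mrank Ms"

definition flag_push_forward ::
    "('b, 'd) tract_data_scheme \<Rightarrow> 'e set \<Rightarrow> ('a \<Rightarrow> 'b) \<Rightarrow> ('e, 'a) coeff_matroid list \<Rightarrow> ('e, 'b) coeff_matroid list" where
  "flag_push_forward F' E f Ms = map (push_forward F' E f) Ms"

definition regular_flag :: "'e set \<Rightarrow> ('e, nat) coeff_matroid list \<Rightarrow> bool" where
  "regular_flag E M \<longleftrightarrow>
     (\<exists>N. flag_matroid F1pm E N \<and> M = flag_push_forward krasner E (to_krasner F1pm) N)"

definition binary_flag :: "'e set \<Rightarrow> ('e, nat) coeff_matroid list \<Rightarrow> bool" where
  "binary_flag E M \<longleftrightarrow>
     (\<exists>N. flag_matroid F2 E N \<and> M = flag_push_forward krasner E (to_krasner F2) N)"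

definition orientable_flag :: "'e set \<Rightarrow> ('e, nat) coeff_matroid list \<Rightarrow> bool" where
  "orientable_flag E M \<longleftrightarrow>
     (\<exists>N. flag_matroid sign_hyperfield E N \<and>
          M = flag_push_forward krasner E (to_krasner sign_hyperfield) N)"


section \<open>Basic properties\<close>

lemma Units_krasner: "Units krasner = {1}"
  by (auto simp: Units_def krasner_def)

lemma Units_F1pm: "Units F1pm = {1, -1}"
  by (auto simp: Units_def F1pm_def)

lemma Units_F2: "Units F2 = {1}"
  by (auto simp: Units_def F2_def)

lemma Units_sign_hyperfield: "Units sign_hyperfield = {1, -1}"
  by (auto simp: Units_def sign_hyperfield_def)

lemma (in tract) tract_epsI:
  assumes "e \<in> Units F" "{#\<one>, e#} \<in> nullset F"
  shows "eps F = e"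
  unfolding eps_def by (rule the1_equality[OF unique_eps]) (use assms in simp)

lemma krasner_nullset_iff: "S \<in> nullset krasner \<longleftrightarrow> set_mset S \<subseteq> {1} \<and> size S \<noteq> 1"
proof
  assume *: "set_mset S \<subseteq> {1} \<and> size S \<noteq> 1"
  then have "S = replicate_mset (size S) 1"
    by (intro set_mset_subset_singletonD) simp
  with * show "S \<in> nullset krasner" unfolding krasner_def tract_data.simps by blast
qed (auto simp: krasner_def split: if_splits)

lemma tract_krasner: "tract krasner"
proof -
  interpret comm_monoid krasner
    by unfold_locales (auto simp: krasner_def)
  show ?thesis
  proof
    show "\<exists>!e. e \<in> Units krasner \<and> {#\<one>\<^bsub>krasner\<^esub>, e#} \<in> nullset krasner"
      unfolding Units_krasner krasner_nullset_iff by (auto simp: krasner_def)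
  next
    fix a S assume "a \<in> Units krasner" "S \<in> nullset krasner"
    then show "{# a \<otimes>\<^bsub>krasner\<^esub> b. b \<in># S #} \<in> nullset krasner"
      unfolding Units_krasner krasner_nullset_iff by (auto simp: krasner_def)
  next
    show "Units krasner = carrier krasner - {tzero krasner}"
      unfolding Units_krasner by (auto simp: krasner_def)
  qed (simp_all add: krasner_nullset_iff Units_krasner, auto simp: krasner_def)
qed

lemma tract_F2: "tract F2"
proof -
  interpret comm_monoid F2
    by unfold_locales (auto simp: F2_def ac_simps)
  show ?thesis
  proof
    show "\<exists>!e. e \<in> Units F2 \<and> {#\<one>\<^bsub>F2\<^esub>, e#} \<in> nullset F2"
      unfolding Units_F2 by (auto simp: F2_def)
  next
    fix S assume "S \<in> nullset F2"
    then show "set_mset S \<subseteq> Units F2"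
      unfolding Units_F2 by (auto simp: F2_def) (metis bit_not_one_iff)
  next
    fix a S assume "a \<in> Units F2" "S \<in> nullset F2"
    then have "a = \<one>\<^bsub>F2\<^esub>" "S \<in> nullset F2" by (simp_all add: Units_F2) (simp add: F2_def)
    moreover have "{# \<one>\<^bsub>F2\<^esub> \<otimes>\<^bsub>F2\<^esub> b. b \<in># S #} = {# b. b \<in># S #}"
      by (intro image_mset_cong l_one) (simp add: F2_def)
    ultimately show "{# a \<otimes>\<^bsub>F2\<^esub> b. b \<in># S #} \<in> nullset F2" by simp
  next
    show "Units F2 = carrier F2 - {tzero F2}"
      unfolding Units_F2 by (auto simp: F2_def)
  qed (auto simp: F2_def)
qed

lemma F1pm_nullset_iff:
  "S \<in> nullset F1pm \<longleftrightarrow> set_mset S \<subseteq> {1, -1} \<and> count S 1 = count S (-1)"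
proof
  assume "set_mset S \<subseteq> {1, -1} \<and> count S 1 = count S (-1)"
  then have "S = replicate_mset (count S 1) 1 + replicate_mset (count S 1) (-1)"
    by (intro multiset_eqI) (auto simp: not_in_iff[symmetric])
  then show "S \<in> nullset F1pm" unfolding F1pm_def by auto
qed (auto simp: F1pm_def split: if_splits)

lemma sign_hyperfield_nullset_iff:
  "S \<in> nullset sign_hyperfield \<longleftrightarrow> set_mset S \<subseteq> {1, -1} \<and> (1 \<in># S \<longleftrightarrow> -1 \<in># S)"
proof
  assume *: "set_mset S \<subseteq> {1, -1} \<and> (1 \<in># S \<longleftrightarrow> -1 \<in># S)"
  then have "S = replicate_mset (count S 1) 1 + replicate_mset (count S (-1)) (-1)"
    by (intro multiset_eqI) (auto simp: not_in_iff[symmetric])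
  moreover have "count S 1 = 0 \<longleftrightarrow> count S (-1) = 0"
    using * by (simp add: count_eq_zero_iff)
  ultimately show "S \<in> nullset sign_hyperfield" unfolding sign_hyperfield_def by auto
qed (auto simp: sign_hyperfield_def split: if_splits)

lemma tract_F1pm: "tract F1pm"
proof -
  interpret comm_monoid F1pm
    by unfold_locales (auto simp: F1pm_def)
  show ?thesis
  proof
    show "\<exists>!e. e \<in> Units F1pm \<and> {#\<one>\<^bsub>F1pm\<^esub>, e#} \<in> nullset F1pm"
      unfolding Units_F1pm F1pm_nullset_iff by (auto simp: F1pm_def)
  next
    fix a S assume "a \<in> Units F1pm" "S \<in> nullset F1pm"
    then show "{# a \<otimes>\<^bsub>F1pm\<^esub> b. b \<in># S #} \<in> nullset F1pm"
      unfolding Units_F1pm by (auto simp: F1pm_def add.commute)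
  next
    show "Units F1pm = carrier F1pm - {tzero F1pm}"
      unfolding Units_F1pm by (auto simp: F1pm_def)
  qed (simp_all add: F1pm_nullset_iff Units_F1pm, auto simp: F1pm_def)
qed

lemma tract_sign_hyperfield: "tract sign_hyperfield"
proof -
  interpret comm_monoid sign_hyperfield
    by unfold_locales (auto simp: sign_hyperfield_def)
  show ?thesis
  proof
    show "\<exists>!e. e \<in> Units sign_hyperfield \<and> {#\<one>\<^bsub>sign_hyperfield\<^esub>, e#} \<in> nullset sign_hyperfield"
      unfolding Units_sign_hyperfield sign_hyperfield_nullset_iff by (auto simp: sign_hyperfield_def)
  next
    fix a S assume "a \<in> Units sign_hyperfield" "S \<in> nullset sign_hyperfield"
    then show "{# a \<otimes>\<^bsub>sign_hyperfield\<^esub> b. b \<in># S #} \<in> nullset sign_hyperfield"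
      unfolding Units_sign_hyperfield sign_hyperfield_nullset_iff
      by (auto simp: sign_hyperfield_def image_iff)
  next
    show "Units sign_hyperfield = carrier sign_hyperfield - {tzero sign_hyperfield}"
      unfolding Units_sign_hyperfield by (auto simp: sign_hyperfield_def)
  qed (simp_all add: sign_hyperfield_nullset_iff Units_sign_hyperfield, auto simp: sign_hyperfield_def)
qed

lemma eps_krasner: "eps krasner = 1"
  by (rule tract.tract_epsI[OF tract_krasner])
     (simp_all add: Units_krasner krasner_nullset_iff, simp_all add: krasner_def)

lemma eps_F1pm: "eps F1pm = -1"
  by (rule tract.tract_epsI[OF tract_F1pm])
     (simp_all add: Units_F1pm F1pm_nullset_iff, simp_all add: F1pm_def)

lemma eps_F2: "eps F2 = 1"
  by (rule tract.tract_epsI[OF tract_F2]) (unfold Units_F2, auto simp: F2_def)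

lemma eps_sign_hyperfield: "eps sign_hyperfield = -1"
  by (rule tract.tract_epsI[OF tract_sign_hyperfield])
     (simp_all add: Units_sign_hyperfield sign_hyperfield_nullset_iff, simp_all add: sign_hyperfield_def)

context tract
begin

lemma to_krasner_hom: "to_krasner F \<in> tract_hom F krasner"
proof -
  have one: "\<one> \<noteq> tzero F" using Units_one_closed Units_eq by auto
  have mult: "to_krasner F (a \<otimes> b) = to_krasner F a * to_krasner F b"
    if "a \<in> carrier F" "b \<in> carrier F" for a b
  proof (cases "a = tzero F \<or> b = tzero F")
    case True
    then show ?thesis
      using that zero_absorbing m_comm[of a b] zero_closed by (auto simp: to_krasner_def)
  next
    case False
    then have "a \<otimes> b \<in> Units F" using that Units_eq by (intro Units_m_closed) auto
    then show ?thesis using False Units_eq by (auto simp: to_krasner_def)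
  qed
  have null: "image_mset (to_krasner F) S \<in> nullset krasner" if S: "S \<in> nullset F" for S
  proof -
    have "image_mset (to_krasner F) S = image_mset (\<lambda>_. 1) S"
      using nullset_Units[OF S] Units_eq by (intro image_mset_cong) (auto simp: to_krasner_def)
    then have eq: "image_mset (to_krasner F) S = replicate_mset (size S) 1"
      by (simp add: image_mset_const_eq)
    have "size S \<noteq> 1"
    proof
      assume "size S = 1"
      then obtain a where a: "S = {#a#}" using size_1_singleton_mset by blast
      then have aU: "a \<in> Units F" using nullset_Units[OF S] by simp
      then have "{# inv a \<otimes> b. b \<in># S #} \<in> nullset F"
        using S by (intro nullset_stable) auto
      then show False using one_not_nullset a aU by simp
    qed
    then show ?thesis unfolding eq krasner_def by auto
  qed
  show ?thesis
    unfolding tract_hom_def hom_def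
    using mult null one by (auto simp: to_krasner_def krasner_def)
qed

lemma to_krasner_unique:
  assumes f: "f \<in> tract_hom F krasner" and a: "a \<in> carrier F"
  shows "f a = to_krasner F a"
proof (cases "a = tzero F")
  case False
  then have aU: "a \<in> Units F" using a Units_eq by simp
  have "f (a \<otimes> inv a) = f a * f (inv a)"
    using f a Units_inv_closed[OF aU] unfolding tract_hom_def hom_def krasner_def by simp
  moreover have "f (a \<otimes> inv a) = 1"
    using f aU by (simp add: tract_hom_def krasner_def)
  ultimately have "f a = 1" by simp
  then show ?thesis using False by (simp add: to_krasner_def)
qed (use f in \<open>auto simp: tract_hom_def krasner_def to_krasner_def\<close>)

lemma gp_class_scale:
  assumes a: "a \<in> Units F" and \<phi>: "\<And>xs. xs \<in> tuples E r \<Longrightarrow> \<phi> xs \<in> carrier F"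
    and \<psi>: "\<And>xs. xs \<in> tuples E r \<Longrightarrow> \<psi> xs = a \<otimes> \<phi> xs"
  shows "gp_class F E r \<psi> = gp_class F E r \<phi>"
proof -
  have "(\<lambda>xs\<in>tuples E r. b \<otimes> \<psi> xs) = (\<lambda>xs\<in>tuples E r. (b \<otimes> a) \<otimes> \<phi> xs)" if "b \<in> Units F" for b
    using that a \<phi> \<psi> by (intro restrict_ext) (simp add: m_assoc Units_closed)
  moreover have "(\<lambda>xs\<in>tuples E r. b \<otimes> \<phi> xs) = (\<lambda>xs\<in>tuples E r. (b \<otimes> inv a) \<otimes> \<psi> xs)"
    if "b \<in> Units F" for b
  proof (intro restrict_ext)
    fix xs assume xs: "xs \<in> tuples E r"
    have "b \<otimes> inv a \<otimes> (a \<otimes> \<phi> xs) = b \<otimes> ((inv a \<otimes> a) \<otimes> \<phi> xs)"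
      using that a \<phi>[OF xs] by (simp only: m_assoc Units_closed Units_inv_closed m_closed)
    then show "b \<otimes> \<phi> xs = b \<otimes> inv a \<otimes> \<psi> xs"
      using that a \<phi>[OF xs] \<psi>[OF xs] by simp
  qed
  ultimately show ?thesis
    unfolding gp_class_def using a by (blast intro: Units_m_closed Units_inv_Units)
qed

lemma push_forward_class:
  assumes "tract F'" and f: "f \<in> tract_hom F F'" and \<phi>: "\<phi> \<in> gp_functions F E r"
  shows "push_forward F' E f \<lparr>mrank = r, mclass = gp_class F E r \<phi>\<rparr> =
         \<lparr>mrank = r, mclass = gp_class F' E r (f \<circ> \<phi>)\<rparr>"
proof -
  interpret F': tract F' by fact
  have \<phi>c: "\<phi> xs \<in> carrier F" if "xs \<in> tuples E r" for xs
    using \<phi> that by (auto simp: gp_functions_def)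
  have fc: "f a \<in> carrier F'" if "a \<in> carrier F" for a
    using f that by (auto simp: tract_hom_def hom_def)
  have fm: "f (a \<otimes> b) = f a \<otimes>\<^bsub>F'\<^esub> f b" if "a \<in> carrier F" "b \<in> carrier F" for a b
    using f that by (auto simp: tract_hom_def hom_def)
  have fU: "f a \<in> Units F'" if "a \<in> Units F" for a
  proof -
    have "f (inv a) \<otimes>\<^bsub>F'\<^esub> f a = \<one>\<^bsub>F'\<^esub>" "f a \<otimes>\<^bsub>F'\<^esub> f (inv a) = \<one>\<^bsub>F'\<^esub>"
      using that f fm[of "inv a" a] fm[of a "inv a"] by (auto simp: tract_hom_def Units_closed)
    then show ?thesis using that fc unfolding Units_def[of F'] by (auto simp: Units_closed)
  qed
  have eq: "gp_class F' E r (f \<circ> \<psi>) = gp_class F' E r (f \<circ> \<phi>)" if \<psi>: "\<psi> \<in> gp_class F E r \<phi>" for \<psi>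
  proof -
    obtain a where a: "a \<in> Units F" "\<psi> = (\<lambda>xs\<in>tuples E r. a \<otimes> \<phi> xs)"
      using \<psi> by (auto simp: gp_class_def)
    show ?thesis
    proof (rule F'.gp_class_scale[OF fU[OF a(1)]])
      fix xs assume xs: "xs \<in> tuples E r"
      show "(f \<circ> \<phi>) xs \<in> carrier F'" using fc \<phi>c[OF xs] by simp
      show "(f \<circ> \<psi>) xs = f a \<otimes>\<^bsub>F'\<^esub> (f \<circ> \<phi>) xs"
        using a xs fm[OF _ \<phi>c[OF xs]] by (simp add: Units_closed)
    qed
  qed
  have "gp_class F E r \<phi> \<noteq> {}" unfolding gp_class_def using Units_one_closed by auto
  then show ?thesis unfolding push_forward_def by (simp add: eq)
qed

end

end

theory Submission
  imports Defs "Jordan_Normal_Form.Determinant"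
begin

text \<open>
  A Grassmann--Pluecker function over \<open>F1pm\<close> is a \<open>{0, 1, -1}\<close>-valued function whose Pluecker sums vanish
  over the integers. If a flag is binary and orientable, take sign-valued functions \<open>\<nu>\<close>, \<open>\<mu>\<close> of
  ranks \<open>r + 1\<close>, \<open>r\<close> orienting it. A Pluecker sum with at most three nonzero terms then has an even
  number of nonzero terms and both signs, so it is zero over the integers.

  These short relations already force all of them: for a tuple \<open>B\<close> with \<open>s = \<nu>(B) \<noteq> 0\<close>
  put \<open>A(x) = (s \<nu>(B[i := x]))\<^sub>i\<close> and \<open>v = (s (-1)\<^sup>i \<mu>(B without B\<^sub>i))\<^sub>i\<close>. An induction on the distance
  from \<open>B\<close> shows \<open>\<nu>(x\<^sub>0, \<dots>, x\<^sub>r) = s det(A(x\<^sub>0), \<dots>, A(x\<^sub>r))\<close> and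
  \<open>\<mu>(x\<^sub>1, \<dots>, x\<^sub>r) = s det(v, A(x\<^sub>1), \<dots>, A(x\<^sub>r))\<close>, that is, \<open>\<nu>\<close> and \<open>\<mu>\<close> are the deletion and the
  contraction of \<open>v\<close> in one matroid represented over the integers, and determinants satisfy all
  Pluecker relations.
  Conversely, \<open>F1pm\<close> maps to both \<open>F2\<close> and the sign hyperfield.
\<close>

section \<open>Alternating functions on tuples\<close>

abbreviation omit :: "nat \<Rightarrow> 'a list \<Rightarrow> 'a list" where
  "omit k ys \<equiv> take k ys @ drop (Suc k) ys"

lemma nth_omit: "k < length ys \<Longrightarrow> Suc i < length ys \<Longrightarrow> omit k ys ! i = ys ! (if i < k then i else Suc i)"
  by (auto simp: nth_append min_def)

lemma mset_omit: "k < length ys \<Longrightarrow> mset ys = add_mset (ys ! k) (mset (omit k ys))"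
  by (metis id_take_nth_drop mset.simps(2) mset_append union_mset_add_mset_right)

lemma tuples_mset_cong: "mset xs = mset ys \<Longrightarrow> xs \<in> tuples E m \<longleftrightarrow> ys \<in> tuples E m"
  unfolding tuples_def by (auto dest: mset_eq_setD mset_eq_length)

lemma omit_in_tuples: "k \<le> m \<Longrightarrow> ys \<in> tuples E (Suc m) \<Longrightarrow> omit k ys \<in> tuples E m"
  by (auto simp: tuples_def dest: in_set_takeD in_set_dropD)

lemma nth_Cons_in_tuples:
  "ys \<in> tuples E w \<Longrightarrow> k < w \<Longrightarrow> set xs \<subseteq> E \<Longrightarrow> Suc (length xs) = r \<Longrightarrow> ys ! k # xs \<in> tuples E r"
  using nth_mem[of k ys] by (auto simp: tuples_def)

lemma swap_in_tuples:
  "xs \<in> tuples E r \<Longrightarrow> i < r \<Longrightarrow> j < r \<Longrightarrow> xs[i := xs ! j, j := xs ! i] \<in> tuples E r"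
  using tuples_mset_cong[OF mset_swap[of j xs i]] by (simp add: tuples_def)

text \<open>Both clauses are kept because the domain may have characteristic two, where the sign
  rule alone does not make the value at a repeated entry vanish.\<close>

definition alternating :: "'e set \<Rightarrow> nat \<Rightarrow> ('e list \<Rightarrow> 'a::idom) \<Rightarrow> bool" where
  "alternating E m \<phi> \<longleftrightarrow> (\<forall>xs \<in> tuples E m. \<forall>i j. i < j \<and> j < m \<longrightarrow>
     \<phi> (xs[i := xs ! j, j := xs ! i]) = - \<phi> xs \<and> (xs ! i = xs ! j \<longrightarrow> \<phi> xs = 0))"

lemma alternating_not_distinct:
  assumes "alternating E m \<phi>" "xs \<in> tuples E m" "\<not> distinct xs"
  shows "\<phi> xs = 0"
proof -
  obtain i j where "i < length xs" "j < length xs" "i \<noteq> j" "xs ! i = xs ! j"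
    using assms(3) by (auto simp: distinct_conv_nth)
  then show ?thesis
    using assms(1,2) unfolding alternating_def tuples_def
    by (cases i j rule: linorder_cases) (fastforce, simp, fastforce)
qed

text \<open>The sign depends only on the two arrangements, not on the function.\<close>

lemma alternating_permute:
  assumes "xs \<in> tuples E m" "mset xs = mset ys"
  shows "\<exists>s. s * s = 1 \<and> (\<forall>\<phi>::'e list \<Rightarrow> 'a::idom. alternating E m \<phi> \<longrightarrow> \<phi> ys = s * \<phi> xs)"
proof -
  obtain p where p: "p permutes {..<length xs}" "permute_list p xs = ys"
    using mset_eq_permutation[OF assms(2)[symmetric]] by metis
  have len: "length xs = m" using assms by (simp add: tuples_def)
  \<comment> \<open>Induction over products of transpositions. The tuple is quantified inside the
    claim, since the induction hypothesis is applied to the transposed tuple.\<close>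
  have "\<forall>xs\<in>tuples E m. \<exists>s. s * s = 1 \<and>
      (\<forall>\<phi>::'e list \<Rightarrow> 'a. alternating E m \<phi> \<longrightarrow> \<phi> (permute_list p xs) = s * \<phi> xs)"
    using p(1)[unfolded len] finite_lessThan
  proof (induction p rule: permutes_induct)
    case id
    then show ?case by (intro ballI exI[of _ 1]) simp
  next
    case (swap a b p)
    show ?case
    proof
      fix xs assume xs: "xs \<in> tuples E m"
      then have lx: "length xs = m" by (simp add: tuples_def)
      let ?zs = "permute_list (Transposition.transpose a b) xs"
      have eq: "permute_list (Transposition.transpose a b \<circ> p) xs = permute_list p ?zs"
        using swap lx by (intro permute_list_compose) auto
      have tp: "Transposition.transpose a b permutes {..<length xs}"
        using swap lx by (intro permutes_swap_id) auto
      have zs: "?zs \<in> tuples E m"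
        using xs tuples_mset_cong[OF mset_permute_list[OF tp]] by simp
      then obtain s where s: "s * s = 1"
        "\<forall>\<phi>::'e list \<Rightarrow> 'a. alternating E m \<phi> \<longrightarrow> \<phi> (permute_list p ?zs) = s * \<phi> ?zs"
        using swap by blast
      have zeq: "?zs = xs[a := xs ! b, b := xs ! a]"
        using swap lx by (intro nth_equalityI)
          (auto simp: permute_list_nth[OF tp] nth_list_update transpose_def)
      have "\<phi> ?zs = - \<phi> xs" if "alternating E m \<phi>" for \<phi> :: "'e list \<Rightarrow> 'a"
        using that xs swap list_update_swap[of a b xs "xs ! b" "xs ! a"] unfolding alternating_def zeq
        by (metis lessThan_iff linorder_neqE_nat)
      then have "\<forall>\<phi>::'e list \<Rightarrow> 'a. alternating E m \<phi> \<longrightarrow> \<phi> (permute_list p ?zs) = (- s) * \<phi> xs"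
        using s(2) by (metis minus_mult_commute)
      then show "\<exists>s. s * s = 1 \<and> (\<forall>\<phi>::'e list \<Rightarrow> 'a. alternating E m \<phi> \<longrightarrow>
          \<phi> (permute_list (Transposition.transpose a b \<circ> p) xs) = s * \<phi> xs)"
        unfolding eq using s(1) by (intro exI[of _ "-s"]) simp
    qed
  qed
  then show ?thesis using assms p by blast
qed

text \<open>Both functions pick up the same sign, so two alternating functions need comparing on one
  arrangement of each set of entries only.\<close>

lemma alternating_permute_eq:
  assumes "alternating E m \<phi>" "alternating E m \<psi>" "xs \<in> tuples E m" "mset xs = mset ys" "\<phi> xs = \<psi> xs"
  shows "\<phi> ys = \<psi> ys"
  using alternating_permute[OF assms(3,4)] assms(1,2,5) by metis

lemma alternating_permute_nonzero:
  assumes "alternating E m \<phi>" "xs \<in> tuples E m" "mset xs = mset ys" "\<phi> xs \<noteq> 0"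
  shows "\<phi> ys \<noteq> 0"
  using alternating_permute[OF assms(2,3)] assms(1,4) by (metis mult_zero_left mult_eq_0_iff zero_neq_one)

section \<open>Three-term relations\<close>

definition gp_sum :: "('e list \<Rightarrow> 'a::idom) \<Rightarrow> ('e list \<Rightarrow> 'a) \<Rightarrow> 'e list \<Rightarrow> 'e list \<Rightarrow> 'a" where
  "gp_sum \<nu> \<mu> ys xs = (\<Sum>k<length ys. (-1) ^ Suc k * \<nu> (omit k ys) * \<mu> (ys ! k # xs))"

text \<open>This is the relation for \<open>(a, c, d, xs)\<close> against \<open>(b, xs)\<close>,
  solved for the product that contains the value at \<open>a # b # xs\<close>. With
  \<open>a\<close>, \<open>b\<close> outside \<open>B\<close> and \<open>c\<close>, \<open>d\<close>
  in \<open>B\<close>, every other tuple in it has an entry of \<open>B\<close> in place of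
  \<open>a\<close> or \<open>b\<close>.\<close>

definition three_term :: "'e set \<Rightarrow> nat \<Rightarrow> ('e list \<Rightarrow> 'a::idom) \<Rightarrow> bool" where
  "three_term E m \<phi> \<longleftrightarrow> (\<forall>a b c d xs. a # b # xs \<in> tuples E m \<and> c \<in> E \<and> d \<in> E \<longrightarrow>
     \<phi> (c # d # xs) * \<phi> (a # b # xs) =
     \<phi> (a # d # xs) * \<phi> (c # b # xs) - \<phi> (a # c # xs) * \<phi> (d # b # xs))"

text \<open>Steinitz exchange towards a spanning set. For \<open>\<mu>\<close> the set
  \<open>B\<close> will be a basis of the larger matroid, so it may have more than \<open>m\<close>
  elements.\<close>

definition exchange_into :: "'e set \<Rightarrow> nat \<Rightarrow> 'e set \<Rightarrow> ('e list \<Rightarrow> 'a::idom) \<Rightarrow> bool" where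
  "exchange_into E m B \<phi> \<longleftrightarrow> (\<forall>a xs. a # xs \<in> tuples E m \<and> \<phi> (a # xs) \<noteq> 0 \<longrightarrow> (\<exists>c\<in>B. \<phi> (c # xs) \<noteq> 0))"

text \<open>Exchange \<open>a\<close>, bring \<open>b\<close> to the front by alternation, and
  exchange \<open>b\<close>.\<close>

lemma three_term_exchange:
  assumes alt: "alternating E m \<phi>" and ex: "exchange_into E m B \<phi>" and B: "B \<subseteq> E"
    and J: "a # b # xs \<in> tuples E m" "\<phi> (a # b # xs) \<noteq> 0" and ab: "a \<notin> B" "b \<notin> B"
  obtains c d where "c \<in> B" "d \<in> B" "c # d # xs \<in> tuples E m" "\<phi> (c # d # xs) \<noteq> 0"
proof -
  obtain c where c: "c \<in> B" "\<phi> (c # b # xs) \<noteq> 0"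
    using ex J unfolding exchange_into_def by blast
  have cb: "c # b # xs \<in> tuples E m" using J c B by (auto simp: tuples_def)
  have bc: "b # c # xs \<in> tuples E m" using J c B by (auto simp: tuples_def)
  have "\<phi> (b # c # xs) \<noteq> 0" by (rule alternating_permute_nonzero[OF alt cb _ c(2)]) simp
  then obtain d where d: "d \<in> B" "\<phi> (d # c # xs) \<noteq> 0"
    using ex bc unfolding exchange_into_def by blast
  moreover have "d # c # xs \<in> tuples E m" using J c d B by (auto simp: tuples_def)
  ultimately show ?thesis using c that by blast
qed

text \<open>Two exchanges towards \<open>B\<close> expose a three-term relation in which the value at a tuple is
  multiplied by a nonzero value and all other tuples are closer to \<open>B\<close>.\<close>

lemma three_term_unique:
  fixes \<phi> \<psi> :: "'e list \<Rightarrow> 'a::idom"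
  assumes alt: "alternating E m \<phi>" "alternating E m \<psi>"
    and tt: "three_term E m \<phi>" "three_term E m \<psi>"
    and ex: "exchange_into E m B \<phi>" "exchange_into E m B \<psi>" and B: "B \<subseteq> E"
    and near: "\<And>xs. xs \<in> tuples E m \<Longrightarrow> distinct xs \<Longrightarrow> card (set xs - B) \<le> 1 \<Longrightarrow> \<phi> xs = \<psi> xs"
    and J: "J \<in> tuples E m"
  shows "\<phi> J = \<psi> J"
  using J
proof (induction "card (set J - B)" arbitrary: J rule: less_induct)
  case less
  consider "\<not> distinct J" | "distinct J" "card (set J - B) \<le> 1" | "distinct J" "card (set J - B) \<ge> 2"
    by linarith
  then show ?case
  proof cases
    case 1
    then show ?thesis using alternating_not_distinct alt less.prems by metis
  next
    case 2
    then show ?thesis using near less.prems by blast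
  next
    case 3
    obtain T where "T \<subseteq> set J - B" "card T = 2" using 3 obtain_subset_with_card_n by metis
    then obtain a b where ab: "a \<in> set J" "b \<in> set J" "a \<notin> B" "b \<notin> B" "a \<noteq> b"
      by (auto simp: card_2_iff)
    define xs where "xs = remove1 b (remove1 a J)"
    have "b \<in> set (remove1 a J)" using ab by simp
    then have m: "mset J = mset (a # b # xs)"
      unfolding xs_def using ab(1) by (metis insert_DiffM mset.simps(2) mset_remove1 set_mset_mset)
    have abx: "a # b # xs \<in> tuples E m" using less.prems tuples_mset_cong[OF m] by blast
    have sJ: "set J = set (a # b # xs)" using m mset_eq_setD by blast
    have dab: "distinct (a # b # xs)" using 3 m mset_eq_imp_distinct_iff by blast
    have IH: "\<phi> T = \<psi> T" if "T \<in> tuples E m" "card (set T - B) < card (set J - B)" for T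
      using less.hyps that by blast
    have close: "\<phi> (p # q # xs) = \<psi> (p # q # xs)"
      if "p \<in> insert a (insert b B)" "q \<in> insert a (insert b B)" "p \<in> B \<or> q \<in> B" for p q
    proof (rule IH)
      show "p # q # xs \<in> tuples E m" using abx that B by (auto simp: tuples_def)
      \<comment> \<open>Distinctness keeps \<open>a\<close> and \<open>b\<close> out of
        \<open>xs\<close>, so an entry from \<open>B\<close> among \<open>p\<close>,
        \<open>q\<close> means that one of them is lost.\<close>
      have "a \<notin> set (p # q # xs) \<or> b \<notin> set (p # q # xs)" using that(3) dab ab by auto
      moreover have "set (p # q # xs) - B \<subseteq> set J - B" using that(1,2) by (auto simp: sJ)
      ultimately have "set (p # q # xs) - B \<subset> set J - B" using ab by blast
      then show "card (set (p # q # xs) - B) < card (set J - B)" by (intro psubset_card_mono) auto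
    qed
    have *: "\<phi> (a # b # xs) = \<psi> (a # b # xs)"
      if cd: "c \<in> B" "d \<in> B" "\<phi> (c # d # xs) \<noteq> 0" for c d
    proof -
      have "\<phi> (c # d # xs) * \<phi> (a # b # xs) = \<psi> (c # d # xs) * \<psi> (a # b # xs)"
        using tt[unfolded three_term_def, rule_format, of a b xs c d] abx cd subsetD[OF B]
          close[of a d] close[of c b] close[of a c] close[of d b] by simp
      moreover have "\<phi> (c # d # xs) = \<psi> (c # d # xs)" using close cd by blast
      ultimately show ?thesis using cd by simp
    qed
    have "\<phi> (a # b # xs) = \<psi> (a # b # xs)"
    proof (cases "\<phi> (a # b # xs) = 0")
      case False
      then show ?thesis using three_term_exchange[OF alt(1) ex(1) B abx _ ab(3,4)] * by metis
    next
      case True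
      show ?thesis
      proof (rule ccontr)
        assume "\<phi> (a # b # xs) \<noteq> \<psi> (a # b # xs)"
        then have "\<psi> (a # b # xs) \<noteq> 0" using True by simp
        \<comment> \<open>Only \<open>\<psi>\<close> is known to be nonzero here, so the exchange is
          made for \<open>\<psi>\<close>; \<open>close\<close> carries the nonzero value at
          \<open>c # d # xs\<close> over to \<open>\<phi>\<close>.\<close>
        then obtain c d where "c \<in> B" "d \<in> B" "\<psi> (c # d # xs) \<noteq> 0"
          using three_term_exchange[OF alt(2) ex(2) B abx _ ab(3,4)] by metis
        then show False using * close \<open>\<phi> (a # b # xs) \<noteq> \<psi> (a # b # xs)\<close> by (metis insert_iff)
      qed
    qed
    then show ?thesis using alternating_permute_eq[OF alt abx m[symmetric]] by blast
  qed
qed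

section \<open>Determinants\<close>

text \<open>Rows are functions, so the same vector can occur in lists of any length; only its first
  \<open>length ws\<close> coordinates are read.\<close>

definition row_det :: "(nat \<Rightarrow> 'a::idom) list \<Rightarrow> 'a" where
  "row_det ws = det (mat (length ws) (length ws) (\<lambda>(i, j). (ws ! i) j))"

lemma row_det_swap:
  assumes "i < length ws" "j < length ws" "i \<noteq> j"
  shows "row_det (ws[i := ws ! j, j := ws ! i]) = - row_det ws"
proof -
  let ?A = "mat (length ws) (length ws) (\<lambda>(i, j). (ws ! i) j)"
  have "det (swaprows i j ?A) = - det ?A" using assms by (intro det_swaprows) auto
  moreover have "swaprows i j ?A =
      mat (length ws) (length ws) (\<lambda>(k, l). (ws[i := ws ! j, j := ws ! i] ! k) l)"
    using assms by (intro eq_matI) (auto simp: nth_list_update)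
  ultimately show ?thesis by (simp add: row_det_def)
qed

lemma row_det_eq_rows:
  assumes "i < length ws" "j < length ws" "i \<noteq> j" "ws ! i = ws ! j"
  shows "row_det ws = 0"
  unfolding row_det_def
  by (rule det_identical_rows[OF _ assms(3,1,2)]) (use assms in auto)

text \<open>Laplace expansion along the first row: the cofactors there do not involve
  \<open>w\<close>, so one \<open>C\<close> serves for all \<open>w\<close>.\<close>

lemma row_det_expand_Cons:
  "\<exists>C. \<forall>w. row_det (w # ws) = (\<Sum>i\<le>length ws. w i * C i)"
proof -
  let ?A = "\<lambda>w. mat (Suc (length ws)) (Suc (length ws)) (\<lambda>(i, j). ((w # ws) ! i) j)"
  have "mat_delete (?A w) 0 i = mat_delete (?A w') 0 i" if "i \<le> length ws" for w w' i
    using that by (intro eq_matI) (auto simp: mat_delete_def)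
  then have cof: "cofactor (?A w) 0 i = cofactor (?A (\<lambda>_. 0)) 0 i" if "i \<le> length ws" for w i
    using that unfolding cofactor_def by metis
  have "row_det (w # ws) = (\<Sum>i\<le>length ws. w i * cofactor (?A (\<lambda>_. 0)) 0 i)" for w
  proof -
    have "row_det (w # ws) = (\<Sum>i<Suc (length ws). ?A w $$ (0, i) * cofactor (?A w) 0 i)"
      unfolding row_det_def by (subst laplace_expansion_row[of _ "Suc (length ws)" 0]) auto
    also have "\<dots> = (\<Sum>i\<le>length ws. w i * cofactor (?A (\<lambda>_. 0)) 0 i)"
      unfolding lessThan_Suc_atMost by (intro sum.cong arg_cong2[where f = "(*)"] cof) auto
    finally show ?thesis .
  qed
  then show ?thesis by (intro exI[of _ "\<lambda>i. cofactor (?A (\<lambda>_. 0)) 0 i"]) blast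
qed

text \<open>Cramer's rule: repeating column \<open>i\<close> of an \<open>m + 1\<close> by \<open>m\<close> matrix gives a singular square matrix,
  which is expanded along the repeated column.\<close>

lemma row_det_linear_dependence:
  assumes len: "length ws = Suc m" and i: "i < m"
  shows "(\<Sum>k\<le>m. (-1) ^ k * row_det (omit k ws) * (ws ! k) i) = 0"
proof -
  let ?A = "mat (Suc m) (Suc m) (\<lambda>(k, j). (ws ! k) (if j = 0 then i else j - 1))"
  have "det ?A = 0"
    by (rule det_identical_columns[of _ "Suc m" 0 "Suc i"]) (use i in \<open>auto intro!: eq_vecI\<close>)
  moreover have "det ?A = (\<Sum>k<Suc m. ?A $$ (k, 0) * cofactor ?A k 0)"
    by (rule laplace_expansion_column) auto
  moreover have "cofactor ?A k 0 = (-1) ^ k * row_det (omit k ws)" if "k \<le> m" for k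
  proof -
    have "mat_delete ?A k 0 = mat m m (\<lambda>(i, j). (omit k ws ! i) j)"
      using that len by (intro eq_matI) (auto simp: mat_delete_def nth_omit)
    then show ?thesis using that len by (simp add: cofactor_def row_det_def min_def)
  qed
  ultimately show ?thesis unfolding lessThan_Suc_atMost
    by (simp add: mult.commute mult.left_commute)
qed

text \<open>Expanding the second determinant along its first row turns the sum into a combination of
  the linear dependences above, one for each coordinate \<open>i\<close>.\<close>

lemma row_det_gp_sum:
  fixes ws vs :: "(nat \<Rightarrow> 'a::idom) list"
  assumes "length ws = Suc (Suc (length vs))"
  shows "gp_sum row_det row_det ws vs = 0"
proof -
  let ?m = "length vs"
  obtain C where C: "\<And>w. row_det (w # vs) = (\<Sum>i\<le>?m. w i * C i)"
    using row_det_expand_Cons[of vs] by blast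
  have "gp_sum row_det row_det ws vs =
      - (\<Sum>k\<le>Suc ?m. \<Sum>i\<le>?m. C i * ((-1) ^ k * row_det (omit k ws) * (ws ! k) i))"
    unfolding gp_sum_def assms lessThan_Suc_atMost C sum_negf[symmetric]
    by (intro sum.cong) (simp_all add: sum_distrib_left mult_ac sum_negf)
  also have "\<dots> = - (\<Sum>i\<le>?m. C i * (\<Sum>k\<le>Suc ?m. (-1) ^ k * row_det (omit k ws) * (ws ! k) i))"
    by (subst sum.swap) (simp only: sum_distrib_left)
  also have "\<dots> = 0"
    using row_det_linear_dependence[of ws "Suc ?m"] assms by simp
  finally show ?thesis .
qed

text \<open>Column \<open>i\<close> vanishes outside row \<open>p\<close>, and deleting both leaves
  the identity matrix. It evaluates the determinants at tuples next to a basis, with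
  \<open>p = i\<close> for \<open>\<nu>\<close> and \<open>p = 0\<close> for
  \<open>\<mu>\<close>.\<close>

lemma row_det_omit_units:
  assumes len: "length ws = Suc n" and p: "p \<le> n" and i: "i \<le> n"
    and units: "\<And>j l. j < n \<Longrightarrow> l \<le> n \<Longrightarrow> (omit p ws ! j) l = of_bool (l = (if j < i then j else Suc j))"
  shows "row_det ws = (-1) ^ (p + i) * (ws ! p) i"
proof -
  let ?A = "mat (Suc n) (Suc n) (\<lambda>(k, j). (ws ! k) j)"
  have "(ws ! k) i = 0" if "k \<le> n" "k \<noteq> p" for k
  proof (cases "k < p")
    case True
    then show ?thesis using units[of k i] i p len by (auto simp: nth_append split: if_splits)
  next
    case False
    then have "omit p ws ! (k - 1) = ws ! k" using that p len by (auto simp: nth_omit)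
    then show ?thesis using False that units[of "k - 1" i] i by (auto split: if_splits)
  qed
  then have "(\<Sum>k<Suc n. ?A $$ (k, i) * cofactor ?A k i) = (\<Sum>k<Suc n. if k = p then (ws ! p) i * cofactor ?A p i else 0)"
    using i by (intro sum.cong) auto
  then have "det ?A = (ws ! p) i * cofactor ?A p i"
    using laplace_expansion_column[of ?A "Suc n" i] i p by auto
  moreover have "mat_delete ?A p i = 1\<^sub>m n"
  proof (rule eq_matI)
    fix j l assume "j < dim_row (1\<^sub>m n)" "l < dim_col (1\<^sub>m n)"
    then have jl: "j < n" "l < n" by auto
    let ?l = "if l < i then l else Suc l"
    have "mat_delete ?A p i $$ (j, l) = (ws ! (if j < p then j else Suc j)) ?l"
      using jl by (auto simp: mat_delete_def)
    also have "\<dots> = (omit p ws ! j) ?l" using jl p len by (subst nth_omit) auto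
    also have "\<dots> = of_bool (?l = (if j < i then j else Suc j))" using jl by (intro units) auto
    also have "\<dots> = 1\<^sub>m n $$ (j, l)" using jl by auto
    finally show "mat_delete ?A p i $$ (j, l) = 1\<^sub>m n $$ (j, l)" .
  qed auto
  ultimately show ?thesis using len by (simp add: row_det_def cofactor_def mult.commute)
qed

section \<open>From three-term relations to all Pluecker relations\<close>

definition gp_terms :: "('e list \<Rightarrow> 'a::idom) \<Rightarrow> ('e list \<Rightarrow> 'a) \<Rightarrow> 'e list \<Rightarrow> 'e list \<Rightarrow> 'a multiset" where
  "gp_terms \<nu> \<mu> ys xs = mset (map (\<lambda>k. (-1) ^ Suc k * \<nu> (omit k ys) * \<mu> (ys ! k # xs)) [0..<length ys])"

lemma gp_sum_conv_terms: "gp_sum \<nu> \<mu> ys xs = sum_mset (gp_terms \<nu> \<mu> ys xs)"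
  by (simp add: gp_sum_def gp_terms_def sum_mset_sum_list sum_unfold_sum_mset atLeast0LessThan)

text \<open>An entry of \<open>ys\<close> stands one position later in \<open>y # ys\<close>, hence
  the \<open>uminus\<close>; when a later entry is omitted, \<open>y\<close> stays in front.\<close>

lemma gp_terms_Cons:
  "gp_terms \<nu> \<mu> (y # ys) xs = add_mset (- \<nu> ys * \<mu> (y # xs)) (image_mset uminus (gp_terms (\<lambda>zs. \<nu> (y # zs)) \<mu> ys xs))"
  unfolding gp_terms_def
  by (simp add: upt_conv_Cons map_Suc_upt[symmetric] multiset.map_comp o_def del: upt_Suc map_Suc_upt)

lemma gp_terms_zero:
  assumes "\<forall>y\<in>set ys. \<mu> (y # xs) = 0" "t \<in># gp_terms \<nu> \<mu> ys xs"
  shows "t = 0"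
  using assms by (auto simp: gp_terms_def)

text \<open>Three is the limit up to which signs and parity force cancellation: 1 + 1 + 1 - 1 has
  both signs and an even number of terms, yet it is not zero.\<close>

definition weakly_null :: "'a::comm_monoid_add multiset \<Rightarrow> bool" where
  "weakly_null S \<longleftrightarrow> (size {# t \<in># S. t \<noteq> 0 #} \<le> 3 \<longrightarrow> sum_mset S = 0)"

lemma weakly_null_sum:
  assumes "weakly_null (M + N)" "\<forall>t\<in>#N. t = 0" "size M \<le> 3"
  shows "sum_mset M = 0"
proof -
  have "size {# t \<in># N. t \<noteq> 0 #} = 0" using assms(2) by (auto simp: multiset_eq_iff not_in_iff)
  then have "size {# t \<in># M + N. t \<noteq> 0 #} \<le> 3"
    using size_filter_mset_lesseq[of "\<lambda>t. t \<noteq> 0" M] assms(3)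
    by (simp only: filter_union_mset size_union)
  moreover have "sum_mset N = 0" using assms(2) by (simp add: sum_mset.neutral)
  ultimately show ?thesis using assms(1) by (simp add: weakly_null_def)
qed

definition weak_gp :: "'e set \<Rightarrow> nat \<Rightarrow> ('e list \<Rightarrow> 'a::idom) \<Rightarrow> nat \<Rightarrow> ('e list \<Rightarrow> 'a) \<Rightarrow> bool" where
  "weak_gp E w \<nu> r \<mu> \<longleftrightarrow> (\<forall>ys \<in> tuples E (Suc w). \<forall>xs. set xs \<subseteq> E \<and> Suc (length xs) = r \<longrightarrow>
     weakly_null (gp_terms \<nu> \<mu> ys xs))"

definition strong_gp :: "'e set \<Rightarrow> nat \<Rightarrow> ('e list \<Rightarrow> 'a::idom) \<Rightarrow> nat \<Rightarrow> ('e list \<Rightarrow> 'a) \<Rightarrow> bool" where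
  "strong_gp E w \<nu> r \<mu> \<longleftrightarrow> (\<forall>ys \<in> tuples E (Suc w). \<forall>xs. set xs \<subseteq> E \<and> Suc (length xs) = r \<longrightarrow>
     gp_sum \<nu> \<mu> ys xs = 0)"

lemma strong_gp_imp_weak_gp: "strong_gp E w \<nu> r \<mu> \<Longrightarrow> weak_gp E w \<nu> r \<mu>"
  unfolding strong_gp_def weak_gp_def weakly_null_def gp_sum_conv_terms by blast

text \<open>The terms that omit an entry of \<open>ys\<close> vanish by \<open>zero\<close>, which
  leaves those omitting \<open>a\<close>, \<open>c\<close> or \<open>d\<close>. It serves a single
  function as well as the mixed relations of \<open>\<nu>\<close> and \<open>\<mu>\<close>.\<close>

lemma weak_gp_three_term:
  assumes gp: "weak_gp E w \<nu> r \<mu>"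
    and ys: "a # c # d # ys \<in> tuples E (Suc w)" and xs: "set xs \<subseteq> E" "Suc (length xs) = r"
    and zero: "\<forall>y\<in>set ys. \<mu> (y # xs) = 0"
  shows "\<nu> (c # d # ys) * \<mu> (a # xs) = \<nu> (a # d # ys) * \<mu> (c # xs) - \<nu> (a # c # ys) * \<mu> (d # xs)"
proof -
  \<comment> \<open>One \<open>uminus\<close> for each of the three entries peeled off.\<close>
  define N where "N = image_mset uminus (image_mset uminus (image_mset uminus
    (gp_terms (\<lambda>zs. \<nu> (a # c # d # zs)) \<mu> ys xs)))"
  have terms: "gp_terms \<nu> \<mu> (a # c # d # ys) xs =
      {# - \<nu> (c # d # ys) * \<mu> (a # xs), \<nu> (a # d # ys) * \<mu> (c # xs), - \<nu> (a # c # ys) * \<mu> (d # xs) #} + N"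
    by (simp add: gp_terms_Cons N_def)
  have N: "\<forall>t\<in>#N. t = 0" using gp_terms_zero[OF zero] by (auto simp: N_def)
  have "weakly_null (gp_terms \<nu> \<mu> (a # c # d # ys) xs)"
    using gp ys xs unfolding weak_gp_def by blast
  from weakly_null_sum[OF this[unfolded terms] N] show ?thesis
    by (simp add: algebra_simps eq_neg_iff_add_eq_0)
qed

text \<open>If no exchange were possible, the relation for \<open>a # B\<close> against
  \<open>xs\<close> would have a single nonzero term, the one that omits \<open>a\<close>.\<close>

lemma weak_gp_exchange_into:
  assumes gp: "weak_gp E w \<nu> r \<mu>" and B: "B \<in> tuples E w" "\<nu> B \<noteq> 0"
  shows "exchange_into E r (set B) \<mu>"
  unfolding exchange_into_def
proof (intro allI impI, rule ccontr)
  fix a xs assume a: "a # xs \<in> tuples E r \<and> \<mu> (a # xs) \<noteq> 0" and "\<not> (\<exists>c\<in>set B. \<mu> (c # xs) \<noteq> 0)"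
  then have zero: "\<forall>c\<in>set B. \<mu> (c # xs) = 0" by blast
  define N where "N = image_mset uminus (gp_terms (\<lambda>zs. \<nu> (a # zs)) \<mu> B xs)"
  have terms: "gp_terms \<nu> \<mu> (a # B) xs = {# - \<nu> B * \<mu> (a # xs) #} + N"
    by (simp add: gp_terms_Cons N_def)
  have N: "\<forall>t\<in>#N. t = 0" using gp_terms_zero[OF zero] by (auto simp: N_def)
  have "weakly_null (gp_terms \<nu> \<mu> (a # B) xs)"
    using gp a B unfolding weak_gp_def by (auto simp: tuples_def)
  from weakly_null_sum[OF this[unfolded terms] N] show False using a B by simp
qed

lemma weak_gp_imp_three_term:
  assumes "weak_gp E m \<phi> m \<phi>" "alternating E m \<phi>"
  shows "three_term E m \<phi>"
  unfolding three_term_def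
proof (intro allI impI)
  fix a b c d xs assume *: "a # b # xs \<in> tuples E m \<and> c \<in> E \<and> d \<in> E"
  show "\<phi> (c # d # xs) * \<phi> (a # b # xs) =
     \<phi> (a # d # xs) * \<phi> (c # b # xs) - \<phi> (a # c # xs) * \<phi> (d # b # xs)"
  proof (rule weak_gp_three_term[OF assms(1)])
    show "\<forall>y\<in>set xs. \<phi> (y # b # xs) = 0"
      using * by (intro ballI alternating_not_distinct[OF assms(2)]) (auto simp: tuples_def)
  qed (use * in \<open>auto simp: tuples_def\<close>)
qed

section \<open>Uniqueness of a pair with given values next to a basis\<close>

definition weak_gp_pair :: "'e set \<Rightarrow> nat \<Rightarrow> ('e list \<Rightarrow> 'a::idom) \<Rightarrow> ('e list \<Rightarrow> 'a) \<Rightarrow> bool" where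
  "weak_gp_pair E r \<nu> \<mu> \<longleftrightarrow> alternating E (Suc r) \<nu> \<and> alternating E r \<mu> \<and>
     weak_gp E (Suc r) \<nu> (Suc r) \<nu> \<and> weak_gp E r \<mu> r \<mu> \<and> weak_gp E (Suc r) \<nu> r \<mu>"

text \<open>By \<open>three_term_unique\<close> it suffices to treat tuples with at most one entry
  outside \<open>B\<close>. For \<open>\<nu>\<close> these are rearrangements of some
  \<open>B[i := x]\<close>. For \<open>\<mu>\<close> those inside \<open>B\<close> are
  rearrangements of some \<open>omit i B\<close>, and the others are reached by a mixed relation
  with \<open>\<nu>\<close>.\<close>

lemma weak_gp_pair_unique:
  fixes \<nu> \<nu>' \<mu> \<mu>' :: "'e list \<Rightarrow> 'a::idom"
  assumes pair: "weak_gp_pair E r \<nu> \<mu>" "weak_gp_pair E r \<nu>' \<mu>'"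
    and B: "B \<in> tuples E (Suc r)" "\<nu> B \<noteq> 0"
    and \<nu>_eq: "\<And>i x. i \<le> r \<Longrightarrow> x \<in> E \<Longrightarrow> \<nu> (B[i := x]) = \<nu>' (B[i := x])"
    and \<mu>_eq: "\<And>i. i \<le> r \<Longrightarrow> \<mu> (omit i B) = \<mu>' (omit i B)"
  shows "xs \<in> tuples E (Suc r) \<Longrightarrow> \<nu> xs = \<nu>' xs" and "xs \<in> tuples E r \<Longrightarrow> \<mu> xs = \<mu>' xs"
proof -
  have alt: "alternating E (Suc r) \<nu>" "alternating E (Suc r) \<nu>'" "alternating E r \<mu>" "alternating E r \<mu>'"
    using pair by (auto simp: weak_gp_pair_def)
  have tt: "three_term E (Suc r) \<nu>" "three_term E (Suc r) \<nu>'" "three_term E r \<mu>" "three_term E r \<mu>'"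
    using pair weak_gp_imp_three_term by (auto simp: weak_gp_pair_def)
  have B': "set B \<subseteq> E" "length B = Suc r" using B by (auto simp: tuples_def)
  have dB: "distinct B" using alternating_not_distinct[OF alt(1)] B by blast
  have cB: "card (set B) = Suc r" using dB B' distinct_card by metis
  \<comment> \<open>\<open>B\<close> itself is \<open>B[0 := B ! 0]\<close>.\<close>
  have \<nu>B: "\<nu> B = \<nu>' B" using \<nu>_eq[of 0 "B ! 0"] B' by (simp add: subset_iff)
  have ex: "exchange_into E (Suc r) (set B) \<nu>" "exchange_into E (Suc r) (set B) \<nu>'"
    "exchange_into E r (set B) \<mu>" "exchange_into E r (set B) \<mu>'"
    using pair B \<nu>B by (auto simp: weak_gp_pair_def intro: weak_gp_exchange_into)
  have \<nu>: "\<nu> xs = \<nu>' xs" if "xs \<in> tuples E (Suc r)" for xs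
  proof (rule three_term_unique[OF alt(1,2) tt(1,2) ex(1,2) B'(1) _ that])
    fix xs assume xs: "xs \<in> tuples E (Suc r)" "distinct xs" "card (set xs - set B) \<le> 1"
    have cx: "card (set xs) = Suc r" using xs distinct_card by (fastforce simp: tuples_def)
    have cd: "card (set B - set xs) = card (set xs - set B)"
      using cB cx by (metis List.finite_set card_Diff_subset_Int finite_Int inf_commute)
    consider "card (set xs - set B) = 0" | "card (set xs - set B) = 1" using xs by linarith
    then show "\<nu> xs = \<nu>' xs"
    proof cases
      case 1
      then have "set xs - set B = {}" "set B - set xs = {}"
        using cd by (metis card_0_eq finite_Diff List.finite_set)+
      then have "set xs = set B" by blast
      then have "mset B = mset xs" using set_eq_iff_mset_eq_distinct dB xs by blast
      then show ?thesis using alternating_permute_eq[OF alt(1,2) B(1)] \<nu>B by blast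
    next
      case 2
      then obtain a b where a: "set xs - set B = {a}" and b: "set B - set xs = {b}"
        using cd by (metis card_1_singletonE)
      then obtain i where i: "i < Suc r" "B ! i = b" using B' in_set_conv_nth by (metis Diff_iff singletonI)
      have aE: "a \<in> E" using a xs by (auto simp: tuples_def)
      have "set (B[i := a]) = set xs" using i a b dB B' by (subst set_update_distinct) auto
      moreover have "distinct (B[i := a])" using dB a by (intro distinct_list_update) auto
      ultimately have "mset (B[i := a]) = mset xs" using set_eq_iff_mset_eq_distinct xs by blast
      moreover have "B[i := a] \<in> tuples E (Suc r)"
        using B' aE set_update_subset_insert[of B i a] by (auto simp: tuples_def)
      ultimately show ?thesis using alternating_permute_eq[OF alt(1,2), of "B[i := a]" xs] \<nu>_eq[of i a] i aE by simp
    qed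
  qed
  \<comment> \<open>Such a tuple misses exactly one entry of \<open>B\<close>.\<close>
  have \<mu>0: "\<mu> xs = \<mu>' xs" if xs: "xs \<in> tuples E r" "distinct xs" "set xs \<subseteq> set B" for xs
  proof -
    have "card (set xs) = r" using xs distinct_card by (fastforce simp: tuples_def)
    then have "card (set B - set xs) = 1" using xs cB by (simp add: card_Diff_subset)
    then obtain b where b: "set B - set xs = {b}" by (metis card_1_singletonE)
    then obtain i where i: "i < Suc r" "B ! i = b" using B' in_set_conv_nth by (metis Diff_iff singletonI)
    have "set B = set (b # xs)" "distinct (b # xs)" using b xs by auto
    then have "mset B = mset (b # xs)" using set_eq_iff_mset_eq_distinct dB by blast
    then have "mset (omit i B) = mset xs" using mset_omit[of i B] i B' by simp
    then show ?thesis
      using alternating_permute_eq[OF alt(3,4)] \<mu>_eq[of i] i xs tuples_mset_cong by (metis less_Suc_eq_le)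
  qed
  have \<mu>: "\<mu> xs = \<mu>' xs" if "xs \<in> tuples E r" for xs
  proof (rule three_term_unique[OF alt(3,4) tt(3,4) ex(3,4) B'(1) _ that])
    fix xs assume xs: "xs \<in> tuples E r" "distinct xs" "card (set xs - set B) \<le> 1"
    then consider "card (set xs - set B) = 0" | "card (set xs - set B) = 1" by linarith
    then show "\<mu> xs = \<mu>' xs"
    proof cases
      case 1
      then show ?thesis using \<mu>0 xs by auto
    next
      case 2
      then obtain a where a: "set xs - set B = {a}" by (metis card_1_singletonE)
      define zs where "zs = remove1 a xs"
      have "a \<in># mset xs" using a by auto
      then have m: "mset (a # zs) = mset xs" by (simp add: zs_def)
      have azs: "a # zs \<in> tuples E r" using tuples_mset_cong[OF m] xs by blast
      have daz: "distinct (a # zs)" using m xs mset_eq_imp_distinct_iff by blast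
      have "set xs = insert a (set zs)" using mset_eq_setD[OF m] by simp
      then have zB: "set zs \<subseteq> set B" using a daz by auto
      have len: "Suc (length zs) = r" using azs by (simp add: tuples_def)
      have "card (set zs) = length zs" using daz by (simp add: distinct_card)
      \<comment> \<open>Here the ranks \<open>r\<close> and \<open>Suc r\<close> enter:
        \<open>B\<close> has \<open>Suc r\<close> entries and \<open>zs\<close> has
        \<open>r - 1\<close>, so exactly two entries of \<open>B\<close> remain and the mixed
        relation for \<open>(a, c, d, zs)\<close> against \<open>zs\<close> has three terms.\<close>
      then have "card (set B - set zs) = 2" using card_Diff_subset[OF _ zB] cB len by simp
      then obtain c d where cd: "set B - set zs = {c, d}" "c \<noteq> d" by (auto simp: card_2_iff)
      have cdB: "c \<in> set B" "d \<in> set B" "c \<notin> set zs" "d \<notin> set zs" using cd(1) by blast+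
      have "set B = set (c # d # zs)" using zB cd(1) by auto
      moreover have "distinct (c # d # zs)" using cdB cd(2) daz by simp
      ultimately have mB: "mset B = mset (c # d # zs)" using set_eq_iff_mset_eq_distinct dB by blast
      have nz: "\<nu> (c # d # zs) \<noteq> 0" by (rule alternating_permute_nonzero[OF alt(1) B(1) mB B(2)])
      have cE: "c \<in> E" "d \<in> E" "a \<in> E" "set zs \<subseteq> E" using cdB B' azs by (auto simp: tuples_def)
      have rel: "f (c # d # zs) * g (a # zs) = f (a # d # zs) * g (c # zs) - f (a # c # zs) * g (d # zs)"
        if "weak_gp_pair E r f g" for f g :: "'e list \<Rightarrow> 'a"
      proof (rule weak_gp_three_term)
        show "weak_gp E (Suc r) f r g" using that by (simp add: weak_gp_pair_def)
        have "alternating E r g" using that by (simp add: weak_gp_pair_def)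
        then show "\<forall>y\<in>set zs. g (y # zs) = 0"
          using cE len by (intro ballI alternating_not_distinct) (auto simp: tuples_def)
      qed (use cE len in \<open>auto simp: tuples_def\<close>)
      have "\<mu> (c # zs) = \<mu>' (c # zs)" "\<mu> (d # zs) = \<mu>' (d # zs)"
        using cdB zB cE len daz \<mu>0[of "c # zs"] \<mu>0[of "d # zs"] by (simp_all add: tuples_def)
      moreover have "\<nu> (p # q # zs) = \<nu>' (p # q # zs)" if "p \<in> {a, c, d}" "q \<in> {a, c, d}" for p q
        using that cE len by (intro \<nu>) (auto simp: tuples_def)
      ultimately have "\<nu> (c # d # zs) * \<mu> (a # zs) = \<nu> (c # d # zs) * \<mu>' (a # zs)"
        using rel[OF pair(1)] rel[OF pair(2)] by simp
      then have "\<mu> (a # zs) = \<mu>' (a # zs)" using nz by simp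
      then show ?thesis using alternating_permute_eq[OF alt(3,4) azs m] by blast
    qed
  qed
  show "xs \<in> tuples E (Suc r) \<Longrightarrow> \<nu> xs = \<nu>' xs" and "xs \<in> tuples E r \<Longrightarrow> \<mu> xs = \<mu>' xs"
    using \<nu> \<mu> by blast+
qed

section \<open>The determinantal pair and its relations\<close>

lemma alternating_scaled_row_det:
  "alternating E m (\<lambda>xs. s * row_det (us @ map A xs))"
  unfolding alternating_def
proof (intro ballI allI impI)
  fix xs i j assume xs: "xs \<in> tuples E m" and ij: "i < j \<and> j < m"
  let ?ws = "us @ map A xs" and ?u = "length us"
  have len: "length xs = m" using xs by (simp add: tuples_def)
  have "us @ map A (xs[i := xs ! j, j := xs ! i]) = ?ws[?u + i := ?ws ! (?u + j), ?u + j := ?ws ! (?u + i)]"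
    using ij len by (simp add: list_update_append map_update)
  then have "row_det (us @ map A (xs[i := xs ! j, j := xs ! i])) = - row_det ?ws"
    using ij len row_det_swap[of "?u + i" ?ws "?u + j"] by simp
  moreover have "row_det ?ws = 0" if "xs ! i = xs ! j"
    using ij len that by (intro row_det_eq_rows[of "?u + i" _ "?u + j"]) auto
  ultimately show "s * row_det (us @ map A (xs[i := xs ! j, j := xs ! i])) = - (s * row_det ?ws) \<and>
    (xs ! i = xs ! j \<longrightarrow> s * row_det ?ws = 0)" by simp
qed

lemma row_det_swap_heads: "row_det (v # w # ws) = - row_det (w # v # ws)"
  using row_det_swap[of 0 "w # v # ws" 1] by simp

text \<open>Each sum is up to sign one of determinants only. In the mixed case \<open>v\<close>
  joins the second list. For \<open>\<mu>\<close> alone it joins both lists: the extra term contains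
  \<open>v\<close> twice and vanishes, and the shift of positions makes up for the sign of moving
  \<open>v\<close> behind \<open>y\<close>.\<close>

lemma strong_gp_row_det:
  fixes A :: "'e \<Rightarrow> nat \<Rightarrow> 'a::idom" and v :: "nat \<Rightarrow> 'a" and s :: 'a
  defines "\<nu> \<equiv> \<lambda>xs. s * row_det (map A xs)" and "\<mu> \<equiv> \<lambda>xs. s * row_det (v # map A xs)"
  shows "strong_gp E (Suc r) \<nu> (Suc r) \<nu>" "strong_gp E r \<mu> r \<mu>" "strong_gp E (Suc r) \<nu> r \<mu>"
proof -
  have om: "map A (omit k ys) = omit k (map A ys)" for k ys by (simp add: take_map drop_map)
  have nn: "gp_sum \<nu> \<nu> ys xs = s * s * gp_sum row_det row_det (map A ys) (map A xs)" for ys xs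
    unfolding gp_sum_def \<nu>_def om by (auto simp: sum_distrib_left mult_ac intro!: sum.cong)
  have nm: "gp_sum \<nu> \<mu> ys xs = - (s * s * gp_sum row_det row_det (map A ys) (v # map A xs))" for ys xs
    unfolding gp_sum_def \<nu>_def \<mu>_def om list.map row_det_swap_heads[of v]
    by (auto simp: sum_distrib_left sum_negf[symmetric] mult_ac intro!: sum.cong)
  have zero: "row_det (v # v # ws) = 0" for ws
    using row_det_eq_rows[of 0 "v # v # ws" 1] by simp
  have mm: "gp_sum \<mu> \<mu> ys xs = s * s * gp_sum row_det row_det (v # map A ys) (v # map A xs)" for ys xs
    unfolding gp_sum_def \<mu>_def om list.map row_det_swap_heads[of v]
    by (simp add: sum.lessThan_Suc_shift zero del: sum.lessThan_Suc)
      (auto simp: sum_distrib_left mult_ac intro!: sum.cong)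
  show "strong_gp E (Suc r) \<nu> (Suc r) \<nu>" "strong_gp E r \<mu> r \<mu>" "strong_gp E (Suc r) \<nu> r \<mu>"
    unfolding strong_gp_def nn mm nm by (auto simp: row_det_gp_sum tuples_def)
qed

text \<open>The condition on \<open>B\<close> makes \<open>\<nu> B\<close> its own inverse, so
  coordinates in the basis \<open>B\<close> can be formed without division.\<close>

theorem weak_gp_pair_imp_strong_gp:
  fixes \<nu> \<mu> :: "'e list \<Rightarrow> 'a::idom"
  assumes pair: "weak_gp_pair E r \<nu> \<mu>" and B: "B \<in> tuples E (Suc r)" "\<nu> B * \<nu> B = 1"
  shows "strong_gp E (Suc r) \<nu> (Suc r) \<nu>" "strong_gp E r \<mu> r \<mu>" "strong_gp E (Suc r) \<nu> r \<mu>"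
proof -
  define s where "s = \<nu> B"
  \<comment> \<open>Coordinate \<open>i\<close> of \<open>x\<close> in the basis \<open>B\<close> by
    Cramer's rule, that is, \<open>\<nu> (B[i := x])\<close> divided by
    \<open>\<nu> B\<close>.\<close>
  define A where "A = (\<lambda>x i. s * \<nu> (B[i := x]))"
  \<comment> \<open>Forced by \<open>\<mu>_eq\<close>: above the unit rows of
    \<open>omit i B\<close>, the first row \<open>v\<close> gives the determinant
    \<open>(-1) ^ i * v i\<close>.\<close>
  define v where "v = (\<lambda>i. s * (-1) ^ i * \<mu> (omit i B))"
  define \<nu>' where "\<nu>' = (\<lambda>xs. s * row_det (map A xs))"
  define \<mu>' where "\<mu>' = (\<lambda>xs. s * row_det (v # map A xs))"
  have strong: "strong_gp E (Suc r) \<nu>' (Suc r) \<nu>'" "strong_gp E r \<mu>' r \<mu>'" "strong_gp E (Suc r) \<nu>' r \<mu>'"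
    unfolding \<nu>'_def \<mu>'_def by (rule strong_gp_row_det)+
  have ss: "s * s = 1" using B by (simp add: s_def)
  have alt: "alternating E (Suc r) \<nu>" using pair by (simp add: weak_gp_pair_def)
  have B': "length B = Suc r" "set B \<subseteq> E" using B by (auto simp: tuples_def)
  \<comment> \<open>Entry \<open>k\<close> of \<open>B\<close> has the unit vector \<open>k\<close>
    as its row, because \<open>B[l := B ! k]\<close> is \<open>B\<close> for \<open>l = k\<close>
    and repeats an entry otherwise.\<close>
  have units: "(map A (omit i B) ! j) l = of_bool (l = (if j < i then j else Suc j))"
    if "i \<le> r" "j < r" "l \<le> r" for i j l
  proof -
    define k where "k = (if j < i then j else Suc j)"
    have k: "k \<le> r" using that by (auto simp: k_def)
    have "map A (omit i B) ! j = A (omit i B ! j)" using that B' by (subst nth_map) auto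
    also have "\<dots> = A (B ! k)" unfolding k_def using that B' by (subst nth_omit) auto
    finally have "(map A (omit i B) ! j) l = s * \<nu> (B[l := B ! k])" by (simp add: A_def)
    also have "\<dots> = of_bool (l = k)"
    proof (cases "l = k")
      case False
      have "B[l := B ! k] ! l = B[l := B ! k] ! k" using False that k B' by simp
      then have "\<not> distinct (B[l := B ! k])"
        using False that k B' by (metis length_list_update less_Suc_eq_le nth_eq_iff_index_eq)
      moreover have "B ! k \<in> E" using B' k nth_mem[of k B] by auto
      then have "B[l := B ! k] \<in> tuples E (Suc r)"
        using B' set_update_subsetI[of B E "B ! k" l] by (simp add: tuples_def)
      ultimately show ?thesis using alternating_not_distinct[OF alt] False by simp
    qed (use ss in \<open>simp add: s_def\<close>)
    finally show ?thesis by (simp add: k_def)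
  qed
  have \<nu>_eq: "\<nu> (B[i := x]) = \<nu>' (B[i := x])" if i: "i \<le> r" and x: "x \<in> E" for i x
  proof -
    have om: "omit i (map A (B[i := x])) = map A (omit i B)"
      by (simp add: take_map drop_map)
    \<comment> \<open>The new row stands in position \<open>i\<close> and the missing unit vector is
      number \<open>i\<close>, so the exponent is even.\<close>
    have "row_det (map A (B[i := x])) = (-1) ^ (i + i) * (map A (B[i := x]) ! i) i"
      by (rule row_det_omit_units[of _ r]) (use i B' in \<open>simp_all only: om units length_map length_list_update\<close>)
    also have "\<dots> = s * \<nu> (B[i := x])" using i B' by (simp add: A_def)
    finally show ?thesis using ss by (simp add: \<nu>'_def mult.assoc[symmetric])
  qed
  have \<mu>_eq: "\<mu> (omit i B) = \<mu>' (omit i B)" if i: "i \<le> r" for i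
  proof -
    have om: "omit 0 (v # ws) = ws" for ws by simp
    \<comment> \<open>The row \<open>v\<close> stands in position 0, and the sign
      \<open>(-1) ^ i\<close> cancels the one in \<open>v\<close>.\<close>
    have "row_det (v # map A (omit i B)) = (-1) ^ (0 + i) * ((v # map A (omit i B)) ! 0) i"
      by (rule row_det_omit_units[of _ r]) (use i B' in \<open>simp_all only: om units\<close>, auto)
    also have "\<dots> = s * \<mu> (omit i B)"
      by (simp add: v_def power_mult_distrib[symmetric] mult.left_commute flip: mult.assoc power_add)
    finally show ?thesis using ss by (simp add: \<mu>'_def mult.assoc[symmetric])
  qed
  have "weak_gp_pair E r \<nu>' \<mu>'"
    unfolding weak_gp_pair_def
    using strong[THEN strong_gp_imp_weak_gp] alternating_scaled_row_det[of E "Suc r" s "[]" A]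
      alternating_scaled_row_det[of E r s "[v]" A]
    by (simp add: \<nu>'_def \<mu>'_def)
  note eq = weak_gp_pair_unique[OF pair this B(1) _ \<nu>_eq \<mu>_eq]
  have nz: "\<nu> B \<noteq> 0" using B by auto
  have om: "omit k ys \<in> tuples E m" if "ys \<in> tuples E (Suc m)" "k < length ys" for k ys m
    using that by (intro omit_in_tuples) (auto simp: tuples_def)
  have cons: "ys ! k # xs \<in> tuples E m"
    if "ys \<in> tuples E w" "k < length ys" "set xs \<subseteq> E" "Suc (length xs) = m" for ys k xs m w
    using that by (intro nth_Cons_in_tuples) (auto simp: tuples_def)
  \<comment> \<open>The sum reads both functions at tuples over \<open>E\<close> only, where they
    agree.\<close>
  have "gp_sum \<nu> \<nu> ys xs = gp_sum \<nu>' \<nu>' ys xs"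
    if "ys \<in> tuples E (Suc (Suc r))" "set xs \<subseteq> E" "Suc (length xs) = Suc r" for ys xs
    unfolding gp_sum_def using that eq(1)[OF nz] om cons
    by (intro sum.cong arg_cong2[where f = "(*)"]) auto
  then show "strong_gp E (Suc r) \<nu> (Suc r) \<nu>" using strong by (simp add: strong_gp_def)
  have "gp_sum \<mu> \<mu> ys xs = gp_sum \<mu>' \<mu>' ys xs"
    if "ys \<in> tuples E (Suc r)" "set xs \<subseteq> E" "Suc (length xs) = r" for ys xs
    unfolding gp_sum_def using that eq(2)[OF nz] om cons
    by (intro sum.cong arg_cong2[where f = "(*)"]) auto
  then show "strong_gp E r \<mu> r \<mu>" using strong by (simp add: strong_gp_def)
  have "gp_sum \<nu> \<mu> ys xs = gp_sum \<nu>' \<mu>' ys xs"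
    if "ys \<in> tuples E (Suc (Suc r))" "set xs \<subseteq> E" "Suc (length xs) = r" for ys xs
    unfolding gp_sum_def using that eq[OF nz] om cons
    by (intro sum.cong arg_cong2[where f = "(*)"]) auto
  then show "strong_gp E (Suc r) \<nu> r \<mu>" using strong by (simp add: strong_gp_def)
qed

section \<open>Reduction to pairs of Grassmann--Pluecker functions\<close>

text \<open>The only unit of \<open>krasner\<close> is 1, so a class over it is a single function.
  This is the one that represents the underlying matroid.\<close>

definition gp_support :: "('a, 'b) tract_data_scheme \<Rightarrow> 'e set \<Rightarrow> nat \<Rightarrow> ('e list \<Rightarrow> 'a) \<Rightarrow> 'e list \<Rightarrow> nat" where
  "gp_support F E r \<phi> = (\<lambda>xs\<in>tuples E r. to_krasner F (\<phi> xs))"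

lemma gp_functions_carrier: "\<phi> \<in> gp_functions F E r \<Longrightarrow> xs \<in> tuples E r \<Longrightarrow> \<phi> xs \<in> carrier F"
  by (auto simp: gp_functions_def)

lemma gp_class_krasner: "gp_class krasner E r \<psi> = {\<lambda>xs\<in>tuples E r. \<psi> xs}"
  unfolding gp_class_def Units_krasner by (simp add: krasner_def)

context tract
begin

lemma eps_Units: "eps F \<in> Units F" and eps_nullset: "{#\<one>, eps F#} \<in> nullset F"
  using theI'[OF unique_eps] unfolding eps_def by blast+

lemma Units_mult_eq_zero_iff:
  assumes "a \<in> Units F" "b \<in> carrier F"
  shows "a \<otimes> b = tzero F \<longleftrightarrow> b = tzero F"
proof
  assume "a \<otimes> b = tzero F"
  then show "b = tzero F" using assms Units_m_closed[of a b] Units_eq by auto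
next
  assume "b = tzero F"
  then show "a \<otimes> b = tzero F"
    using assms zero_absorbing[of a] zero_closed m_comm[of a b] by (simp add: Units_closed)
qed

lemma null_sum_scale:
  assumes a: "a \<in> Units F" and S: "set_mset S \<subseteq> carrier F" "null_sum F S"
  shows "null_sum F {# a \<otimes> b. b \<in># S #}"
proof -
  have "{# c \<in># {# a \<otimes> b. b \<in># S #}. c \<noteq> tzero F #} = {# a \<otimes> b. b \<in># {# b \<in># S. b \<noteq> tzero F #} #}"
    unfolding filter_mset_image_mset using S Units_mult_eq_zero_iff[OF a]
    by (intro arg_cong[where f = "image_mset _"] filter_mset_cong) auto
  then show ?thesis using S(2) nullset_stable[OF a] by (simp add: null_sum_def)
qed

text \<open>Every term is multiplied by the same unit \<open>a \<otimes> b\<close>, and the nullset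
  is stable under units. Hence a quotient can be tested on representatives.\<close>

lemma pluecker_relations_scale:
  assumes gp: "pluecker_relations F E w \<nu> r \<mu>"
    and \<nu>: "\<And>xs. xs \<in> tuples E w \<Longrightarrow> \<nu> xs \<in> carrier F"
    and \<mu>: "\<And>xs. xs \<in> tuples E r \<Longrightarrow> \<mu> xs \<in> carrier F"
    and ab: "a \<in> Units F" "b \<in> Units F"
  shows "pluecker_relations F E w (\<lambda>xs\<in>tuples E w. a \<otimes> \<nu> xs) r (\<lambda>xs\<in>tuples E r. b \<otimes> \<mu> xs)"
  unfolding pluecker_relations_def
proof (intro ballI allI impI)
  fix ys xs assume ys: "ys \<in> tuples E (Suc w)" and xs: "set xs \<subseteq> E \<and> Suc (length xs) = r"
  let ?t = "\<lambda>k. eps F [^] Suc k \<otimes> \<nu> (omit k ys) \<otimes> \<mu> (ys ! k # xs)"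
  have om: "omit k ys \<in> tuples E w" and co: "ys ! k # xs \<in> tuples E r" if "k \<le> w" for k
    using that ys xs omit_in_tuples nth_Cons_in_tuples[of ys E "Suc w" k xs r] by auto
  have t: "?t k \<in> carrier F" if "k \<le> w" for k
    using \<nu>[OF om[OF that]] \<mu>[OF co[OF that]] eps_Units by (auto simp: Units_closed)
  have eq: "eps F [^] Suc k \<otimes> (\<lambda>xs\<in>tuples E w. a \<otimes> \<nu> xs) (omit k ys) \<otimes> (\<lambda>xs\<in>tuples E r. b \<otimes> \<mu> xs) (ys ! k # xs)
      = (a \<otimes> b) \<otimes> ?t k" if k: "k \<le> w" for k
  proof -
    have c: "\<nu> (omit k ys) \<in> carrier F" "\<mu> (ys ! k # xs) \<in> carrier F" "eps F [^] Suc k \<in> carrier F"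
      "a \<in> carrier F" "b \<in> carrier F"
      using \<nu>[OF om[OF k]] \<mu>[OF co[OF k]] eps_Units ab by (auto simp: Units_closed)
    show ?thesis
      using c om[OF k] co[OF k] by (simp only: restrict_apply' m_assoc m_lcomm m_closed)
  qed
  have "null_sum F {# ?t k. k \<in># mset_set {0..w} #}"
    using gp ys xs unfolding pluecker_relations_def by blast
  then have "null_sum F {# (a \<otimes> b) \<otimes> c. c \<in># {# ?t k. k \<in># mset_set {0..w} #} #}"
    using t ab by (intro null_sum_scale Units_m_closed) auto
  also have "{# (a \<otimes> b) \<otimes> c. c \<in># {# ?t k. k \<in># mset_set {0..w} #} #} =
    {# eps F [^] Suc k \<otimes> (\<lambda>xs\<in>tuples E w. a \<otimes> \<nu> xs) (omit k ys) \<otimes>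
         (\<lambda>xs\<in>tuples E r. b \<otimes> \<mu> xs) (ys ! k # xs). k \<in># mset_set {0..w} #}"
    unfolding multiset.map_comp using eq by (intro image_mset_cong) (simp only: o_def, auto)
  finally show "null_sum F {# eps F [^] Suc k \<otimes> (\<lambda>xs\<in>tuples E w. a \<otimes> \<nu> xs) (omit k ys) \<otimes>
         (\<lambda>xs\<in>tuples E r. b \<otimes> \<mu> xs) (ys ! k # xs). k \<in># mset_set {0..w} #}" .
qed

lemma gp_class_self:
  assumes "\<phi> \<in> gp_functions F E r"
  shows "\<phi> \<in> gp_class F E r \<phi>"
proof -
  have "\<phi> = (\<lambda>xs\<in>tuples E r. \<one> \<otimes> \<phi> xs)"
    using assms gp_functions_carrier[OF assms]
    by (auto simp: gp_functions_def PiE_iff extensional_def restrict_def)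
  then show ?thesis unfolding gp_class_def using Units_one_closed by blast
qed

lemma matroid_quotient_gp_class:
  assumes "\<nu> \<in> gp_functions F E w" "\<mu> \<in> gp_functions F E r"
  shows "matroid_quotient F E \<lparr>mrank = w, mclass = gp_class F E w \<nu>\<rparr> \<lparr>mrank = r, mclass = gp_class F E r \<mu>\<rparr>
    \<longleftrightarrow> pluecker_relations F E w \<nu> r \<mu>"
proof
  assume "pluecker_relations F E w \<nu> r \<mu>"
  from pluecker_relations_scale[OF this gp_functions_carrier[OF assms(1)] gp_functions_carrier[OF assms(2)]]
  show "matroid_quotient F E \<lparr>mrank = w, mclass = gp_class F E w \<nu>\<rparr> \<lparr>mrank = r, mclass = gp_class F E r \<mu>\<rparr>"
    unfolding matroid_quotient_def gp_class_def by auto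
qed (use assms[THEN gp_class_self] in \<open>auto simp: matroid_quotient_def\<close>)

lemma push_forward_to_krasner:
  assumes "\<phi> \<in> gp_functions F E r"
  shows "push_forward krasner E (to_krasner F) \<lparr>mrank = r, mclass = gp_class F E r \<phi>\<rparr> =
    \<lparr>mrank = r, mclass = {gp_support F E r \<phi>}\<rparr>"
  using push_forward_class[OF tract_krasner to_krasner_hom assms]
  by (simp add: gp_class_krasner gp_support_def)

text \<open>This removes the classes: lifting a flag with two constituents amounts to finding two
  functions with prescribed supports and a mixed relation.\<close>

lemma flag_lift_iff:
  assumes "flag_rank M = [r, w]"
  shows "(\<exists>N. flag_matroid F E N \<and> M = flag_push_forward krasner E (to_krasner F) N) \<longleftrightarrow>
    (\<exists>\<mu> \<in> gp_functions F E r. \<exists>\<nu> \<in> gp_functions F E w. pluecker_relations F E w \<nu> r \<mu> \<and>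
       M = [\<lparr>mrank = r, mclass = {gp_support F E r \<mu>}\<rparr>, \<lparr>mrank = w, mclass = {gp_support F E w \<nu>}\<rparr>])"
    (is "?L \<longleftrightarrow> ?R")
proof
  assume ?L
  then obtain N where N: "flag_matroid F E N" "M = flag_push_forward krasner E (to_krasner F) N" by blast
  then have "map mrank N = [r, w]"
    using assms by (simp add: flag_rank_def flag_push_forward_def push_forward_def comp_def)
  then obtain N1 N2 where N12: "N = [N1, N2]" "mrank N1 = r" "mrank N2 = w" by auto
  have "N1 \<in> coeff_matroids F E" "N2 \<in> coeff_matroids F E"
    using N(1) N12 by (auto simp: flag_matroid_def)
  then obtain \<mu> \<nu> where \<mu>: "\<mu> \<in> gp_functions F E r" "N1 = \<lparr>mrank = r, mclass = gp_class F E r \<mu>\<rparr>"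
    and \<nu>: "\<nu> \<in> gp_functions F E w" "N2 = \<lparr>mrank = w, mclass = gp_class F E w \<nu>\<rparr>"
    using N12 by (auto simp: coeff_matroids_def)
  have "matroid_quotient F E N2 N1"
    using N(1) N12(1) unfolding flag_matroid_def
    by (metis One_nat_def length_Cons lessI list.size(3) nth_Cons_0 nth_Cons_Suc)
  then have "pluecker_relations F E w \<nu> r \<mu>"
    using matroid_quotient_gp_class[OF \<nu>(1) \<mu>(1)] \<mu>(2) \<nu>(2) by simp
  moreover have "M = [\<lparr>mrank = r, mclass = {gp_support F E r \<mu>}\<rparr>, \<lparr>mrank = w, mclass = {gp_support F E w \<nu>}\<rparr>]"
    unfolding N(2) N12(1) \<mu>(2) \<nu>(2) flag_push_forward_def
    by (simp add: push_forward_to_krasner \<mu>(1) \<nu>(1))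
  ultimately show ?R using \<mu>(1) \<nu>(1) by blast
next
  assume ?R
  then obtain \<mu> \<nu> where gp: "\<mu> \<in> gp_functions F E r" "\<nu> \<in> gp_functions F E w" "pluecker_relations F E w \<nu> r \<mu>"
    and M: "M = [\<lparr>mrank = r, mclass = {gp_support F E r \<mu>}\<rparr>, \<lparr>mrank = w, mclass = {gp_support F E w \<nu>}\<rparr>]"
    by blast
  let ?N = "[\<lparr>mrank = r, mclass = gp_class F E r \<mu>\<rparr>, \<lparr>mrank = w, mclass = gp_class F E w \<nu>\<rparr>]"
  have "matroid_quotient F E (?N ! j) (?N ! i)" if "i < j" "j < length ?N" for i j
  proof -
    have "i = 0" "j = 1" using that by auto
    then show ?thesis using matroid_quotient_gp_class[OF gp(2,1)] gp(3) by simp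
  qed
  then have "flag_matroid F E ?N"
    using gp unfolding flag_matroid_def by (auto simp: coeff_matroids_def)
  moreover have "M = flag_push_forward krasner E (to_krasner F) ?N"
    using M push_forward_to_krasner[OF gp(1)] push_forward_to_krasner[OF gp(2)]
    by (simp add: flag_push_forward_def)
  ultimately show ?L by blast
qed

end

section \<open>Push-forward along tract morphisms\<close>

locale tract_morphism = F: tract F + F': tract F'
  for F :: "('a, 'c) tract_data_scheme" and F' :: "('b, 'd) tract_data_scheme" +
  fixes f :: "'a \<Rightarrow> 'b"
  assumes hom: "f \<in> tract_hom F F'"
begin

lemma closed: "a \<in> carrier F \<Longrightarrow> f a \<in> carrier F'"
  and mult: "a \<in> carrier F \<Longrightarrow> b \<in> carrier F \<Longrightarrow> f (a \<otimes>\<^bsub>F\<^esub> b) = f a \<otimes>\<^bsub>F'\<^esub> f b"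
  and zero: "f (tzero F) = tzero F'"
  and one: "f \<one>\<^bsub>F\<^esub> = \<one>\<^bsub>F'\<^esub>"
  and nullset: "S \<in> nullset F \<Longrightarrow> image_mset f S \<in> nullset F'"
  using hom by (auto simp: tract_hom_def hom_def)

lemma Units: "a \<in> Units F \<Longrightarrow> f a \<in> Units F'"
  using mult[of a "inv\<^bsub>F\<^esub> a"] mult[of "inv\<^bsub>F\<^esub> a" a] one closed
  unfolding Units_def[of F'] by (force simp: F.Units_closed)

text \<open>Units go to units, which are never zero; this is why push-forward keeps
  supports.\<close>

lemma eq_zero_iff: "a \<in> carrier F \<Longrightarrow> f a = tzero F' \<longleftrightarrow> a = tzero F"
  using Units[of a] zero F.Units_eq F'.Units_eq by auto

text \<open>The image of \<open>1 + eps F\<close> is null, and \<open>eps F'\<close> is the only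
  unit with this property.\<close>

lemma eps: "f (eps F) = eps F'"
  using nullset[OF F.eps_nullset] one Units[OF F.eps_Units] F'.tract_epsI by simp

lemma nat_pow: "a \<in> carrier F \<Longrightarrow> f (a [^]\<^bsub>F\<^esub> (n::nat)) = f a [^]\<^bsub>F'\<^esub> n"
  by (induction n) (simp_all add: one mult)

lemma null_sum_image:
  assumes "set_mset S \<subseteq> carrier F" "null_sum F S"
  shows "null_sum F' (image_mset f S)"
proof -
  have "{# b \<in># image_mset f S. b \<noteq> tzero F' #} = image_mset f {# a \<in># S. a \<noteq> tzero F #}"
    unfolding filter_mset_image_mset using assms(1) eq_zero_iff
    by (intro arg_cong[where f = "image_mset _"] filter_mset_cong) auto
  then show ?thesis using assms(2) nullset by (simp add: null_sum_def)
qed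

lemma pluecker_relations_image:
  assumes gp: "pluecker_relations F E w \<nu> r \<mu>"
    and \<nu>: "\<And>xs. xs \<in> tuples E w \<Longrightarrow> \<nu> xs \<in> carrier F"
    and \<mu>: "\<And>xs. xs \<in> tuples E r \<Longrightarrow> \<mu> xs \<in> carrier F"
  shows "pluecker_relations F' E w (\<lambda>xs\<in>tuples E w. f (\<nu> xs)) r (\<lambda>xs\<in>tuples E r. f (\<mu> xs))"
  unfolding pluecker_relations_def
proof (intro ballI allI impI)
  fix ys xs assume ys: "ys \<in> tuples E (Suc w)" and xs: "set xs \<subseteq> E \<and> Suc (length xs) = r"
  let ?t = "\<lambda>k. eps F [^]\<^bsub>F\<^esub> Suc k \<otimes>\<^bsub>F\<^esub> \<nu> (omit k ys) \<otimes>\<^bsub>F\<^esub> \<mu> (ys ! k # xs)"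
  have om: "omit k ys \<in> tuples E w" and co: "ys ! k # xs \<in> tuples E r" if "k \<le> w" for k
    using that ys xs omit_in_tuples nth_Cons_in_tuples[of ys E "Suc w" k xs r] by auto
  have t: "?t k \<in> carrier F" if "k \<le> w" for k
    using \<nu>[OF om[OF that]] \<mu>[OF co[OF that]] F.eps_Units by (auto simp: F.Units_closed)
  have eq: "f (?t k) = eps F' [^]\<^bsub>F'\<^esub> Suc k \<otimes>\<^bsub>F'\<^esub> (\<lambda>xs\<in>tuples E w. f (\<nu> xs)) (omit k ys) \<otimes>\<^bsub>F'\<^esub>
      (\<lambda>xs\<in>tuples E r. f (\<mu> xs)) (ys ! k # xs)" if k: "k \<le> w" for k
  proof -
    have c: "\<nu> (omit k ys) \<in> carrier F" "\<mu> (ys ! k # xs) \<in> carrier F" "eps F \<in> carrier F"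
      "eps F [^]\<^bsub>F\<^esub> Suc k \<in> carrier F"
      using \<nu>[OF om[OF k]] \<mu>[OF co[OF k]] F.eps_Units by (auto simp: F.Units_closed)
    show ?thesis
      using c om[OF k] co[OF k] by (simp only: restrict_apply' mult F.m_closed nat_pow eps)
  qed
  have "null_sum F {# ?t k. k \<in># mset_set {0..w} #}"
    using gp ys xs unfolding pluecker_relations_def by blast
  then have "null_sum F' (image_mset f {# ?t k. k \<in># mset_set {0..w} #})"
    using t by (intro null_sum_image) auto
  also have "image_mset f {# ?t k. k \<in># mset_set {0..w} #} =
    {# eps F' [^]\<^bsub>F'\<^esub> Suc k \<otimes>\<^bsub>F'\<^esub> (\<lambda>xs\<in>tuples E w. f (\<nu> xs)) (omit k ys) \<otimes>\<^bsub>F'\<^esub>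
      (\<lambda>xs\<in>tuples E r. f (\<mu> xs)) (ys ! k # xs). k \<in># mset_set {0..w} #}"
    unfolding multiset.map_comp using eq by (intro image_mset_cong) (simp only: o_def, auto)
  finally show "null_sum F' {# eps F' [^]\<^bsub>F'\<^esub> Suc k \<otimes>\<^bsub>F'\<^esub> (\<lambda>xs\<in>tuples E w. f (\<nu> xs)) (omit k ys) \<otimes>\<^bsub>F'\<^esub>
      (\<lambda>xs\<in>tuples E r. f (\<mu> xs)) (ys ! k # xs). k \<in># mset_set {0..w} #}" .
qed

lemma gp_functions_image:
  assumes \<phi>: "\<phi> \<in> gp_functions F E r"
  shows "(\<lambda>xs\<in>tuples E r. f (\<phi> xs)) \<in> gp_functions F' E r"
proof -
  note c = gp_functions_carrier[OF \<phi>]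
  have gp: "pluecker_relations F E r \<phi> r \<phi>" and ne: "\<exists>xs\<in>tuples E r. \<phi> xs \<noteq> tzero F"
    and alt: "\<And>xs i j. xs \<in> tuples E r \<Longrightarrow> i < j \<Longrightarrow> j < r \<Longrightarrow>
        \<phi> (xs[i := xs ! j, j := xs ! i]) = eps F \<otimes>\<^bsub>F\<^esub> \<phi> xs \<and> (xs ! i = xs ! j \<longrightarrow> \<phi> xs = tzero F)"
    using \<phi> unfolding gp_functions_def by blast+
  show ?thesis
    unfolding gp_functions_def
  proof (intro CollectI conjI ballI allI impI)
    show "pluecker_relations F' E r (\<lambda>xs\<in>tuples E r. f (\<phi> xs)) r (\<lambda>xs\<in>tuples E r. f (\<phi> xs))"
      by (rule pluecker_relations_image[OF gp c c])
    show "\<exists>xs\<in>tuples E r. (\<lambda>xs\<in>tuples E r. f (\<phi> xs)) xs \<noteq> tzero F'"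
      using ne eq_zero_iff c by (metis restrict_apply')
  next
    fix xs i j assume *: "xs \<in> tuples E r" "i < j \<and> j < r"
    then show "(\<lambda>xs\<in>tuples E r. f (\<phi> xs)) (xs[i := xs ! j, j := xs ! i]) =
        eps F' \<otimes>\<^bsub>F'\<^esub> (\<lambda>xs\<in>tuples E r. f (\<phi> xs)) xs"
      using swap_in_tuples[of xs E r i j] alt[of xs i j] mult[of "eps F" "\<phi> xs"] c F.eps_Units eps
      by (simp add: F.Units_closed)
    show "(\<lambda>xs\<in>tuples E r. f (\<phi> xs)) xs = tzero F'" if "xs ! i = xs ! j"
      using * that alt[of xs i j] zero by simp
  qed (use c closed in auto)
qed

lemma gp_support_image:
  assumes "\<phi> \<in> gp_functions F E r"
  shows "gp_support F' E r (\<lambda>xs\<in>tuples E r. f (\<phi> xs)) = gp_support F E r \<phi>"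
  unfolding gp_support_def
  using eq_zero_iff gp_functions_carrier[OF assms] by (intro restrict_ext) (simp add: to_krasner_def)

text \<open>Composing a lift over \<open>F\<close> with \<open>f\<close> changes no support, so the
  result lifts the same \<open>M\<close>.\<close>

lemma flag_lift_image:
  assumes "flag_rank M = [r, w]"
    and "\<exists>N. flag_matroid F E N \<and> M = flag_push_forward krasner E (to_krasner F) N"
  shows "\<exists>N. flag_matroid F' E N \<and> M = flag_push_forward krasner E (to_krasner F') N"
proof -
  obtain \<mu> \<nu> where gp: "\<mu> \<in> gp_functions F E r" "\<nu> \<in> gp_functions F E w" "pluecker_relations F E w \<nu> r \<mu>"
    and M: "M = [\<lparr>mrank = r, mclass = {gp_support F E r \<mu>}\<rparr>, \<lparr>mrank = w, mclass = {gp_support F E w \<nu>}\<rparr>]"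
    using assms(2) unfolding F.flag_lift_iff[OF assms(1)] by blast
  show ?thesis
    unfolding F'.flag_lift_iff[OF assms(1)]
  proof (intro bexI conjI)
    show "pluecker_relations F' E w (\<lambda>xs\<in>tuples E w. f (\<nu> xs)) r (\<lambda>xs\<in>tuples E r. f (\<mu> xs))"
      using gp gp_functions_carrier by (intro pluecker_relations_image) blast+
  qed (use M gp in \<open>simp_all add: gp_support_image gp_functions_image\<close>)
qed

end

text \<open>Reduction modulo 2: equally many terms 1 and -1 make an even number of ones.\<close>

lemma tract_morphism_F1pm_F2: "tract_morphism F1pm F2 of_int"
proof -
  have "image_mset of_int S \<in> nullset F2" if "S \<in> nullset F1pm" for S
    using that by (auto simp: F1pm_def F2_def split: if_splits)
  then have "of_int \<in> tract_hom F1pm F2"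
    by (auto simp: tract_hom_def hom_def F1pm_def F2_def)
  then show ?thesis
    using tract_F1pm tract_F2 by (simp add: tract_morphism_def tract_morphism_axioms_def)
qed

text \<open>If 1 and -1 occur equally often, then both occur or neither does.\<close>

lemma tract_morphism_F1pm_sign_hyperfield: "tract_morphism F1pm sign_hyperfield id"
proof -
  have "S \<in> nullset sign_hyperfield" if "S \<in> nullset F1pm" for S
    using that unfolding F1pm_nullset_iff sign_hyperfield_nullset_iff
    by (metis count_greater_zero_iff)
  then have "id \<in> tract_hom F1pm sign_hyperfield"
    by (auto simp: tract_hom_def hom_def) (auto simp: F1pm_def sign_hyperfield_def)
  then show ?thesis
    using tract_F1pm tract_sign_hyperfield by (simp add: tract_morphism_def tract_morphism_axioms_def)
qed

section \<open>Binary and orientable implies regular\<close>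

lemma sum_mset_filter_nonzero: "sum_mset {# t \<in># S. t \<noteq> 0 #} = sum_mset S"
  by (induction S) auto

lemma signed_multiset:
  fixes S :: "int multiset"
  assumes "set_mset S \<subseteq> {0, 1, -1}"
  shows "{# t \<in># S. t \<noteq> 0 #} = replicate_mset (count S 1) 1 + replicate_mset (count S (-1)) (-1)"
    and "sum_mset S = int (count S 1) - int (count S (-1))"
proof -
  show 1: "{# t \<in># S. t \<noteq> 0 #} = replicate_mset (count S 1) 1 + replicate_mset (count S (-1)) (-1)"
    using assms by (intro multiset_eqI) (auto simp: not_in_iff[symmetric])
  show "sum_mset S = int (count S 1) - int (count S (-1))"
    using sum_mset_filter_nonzero[of S] unfolding 1 by simp
qed

text \<open>With \<open>p\<close> terms 1 and \<open>q\<close> terms -1, both sides say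
  \<open>p = q\<close>.\<close>

lemma null_sum_F1pm_iff:
  assumes "set_mset S \<subseteq> {0, 1, -1}"
  shows "null_sum F1pm S \<longleftrightarrow> sum_mset S = 0"
proof -
  have "tzero F1pm = 0" by (simp add: F1pm_def)
  then show ?thesis
    unfolding null_sum_def F1pm_nullset_iff using signed_multiset[OF assms] by auto
qed

lemma null_sum_sign_hyperfield_iff:
  assumes "set_mset S \<subseteq> {0, 1, -1}"
  shows "null_sum sign_hyperfield S \<longleftrightarrow> (1 \<in># S \<longleftrightarrow> -1 \<in># S)"
  using assms unfolding null_sum_def sign_hyperfield_nullset_iff by (auto simp: sign_hyperfield_def)

lemma null_sum_F2_iff: "null_sum F2 S \<longleftrightarrow> sum_mset S = 0"
proof -
  have F2: "tzero F2 = 0" "nullset F2 = {S. 0 \<notin># S \<and> sum_mset S = 0}" by (simp_all add: F2_def)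
  show ?thesis
    unfolding null_sum_def F2 mem_Collect_eq sum_mset_filter_nonzero by simp
qed

text \<open>At most three nonzero signs, both of which occur and whose number is even: one of each.\<close>

lemma weakly_null_signs:
  assumes "set_mset S \<subseteq> {0, 1, -1}" "null_sum sign_hyperfield S" "even (sum_mset S)"
  shows "weakly_null S"
proof -
  define p q where pq: "p = count S 1" "q = count S (-1)"
  have "p = 0 \<longleftrightarrow> q = 0"
    using assms(2) unfolding null_sum_sign_hyperfield_iff[OF assms(1)] pq by (simp add: count_eq_zero_iff)
  moreover have "even (int p - int q)" using assms(3) signed_multiset(2)[OF assms(1)] by (simp add: pq)
  ultimately have "p + q \<le> 3 \<longrightarrow> p = q" by presburger
  then show ?thesis unfolding weakly_null_def signed_multiset[OF assms(1)] by (simp add: pq[symmetric])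
qed

text \<open>One form for three tracts: \<open>F1pm\<close> and \<open>sign_hyperfield\<close> sit in
  the integers, \<open>F2\<close> in the two-element field, where -1 is 1.\<close>

lemma pluecker_relations_conv_gp_terms:
  fixes F :: "('a::idom, 'b) tract_data_scheme"
  assumes F: "monoid.mult F = (*)" "one F = 1" "eps F = -1"
  shows "pluecker_relations F E w \<nu> r \<mu> \<longleftrightarrow>
    (\<forall>ys \<in> tuples E (Suc w). \<forall>xs. set xs \<subseteq> E \<and> Suc (length xs) = r \<longrightarrow> null_sum F (gp_terms \<nu> \<mu> ys xs))"
proof -
  have pow: "x [^]\<^bsub>F\<^esub> n = x ^ n" for x and n :: nat
    by (induction n) (simp_all add: nat_pow_def F)
  have "{# eps F [^]\<^bsub>F\<^esub> Suc k \<otimes>\<^bsub>F\<^esub> \<nu> (omit k ys) \<otimes>\<^bsub>F\<^esub> \<mu> (ys ! k # xs). k \<in># mset_set {0..w} #} =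
      gp_terms \<nu> \<mu> ys xs" if "ys \<in> tuples E (Suc w)" for ys xs
  proof -
    have "length ys = Suc w" using that by (simp add: tuples_def)
    then show ?thesis
      by (simp only: gp_terms_def mset_map mset_upt atLeastLessThanSuc_atLeastAtMost pow F)
  qed
  then show ?thesis unfolding pluecker_relations_def by simp
qed

lemma eps_F2_minus_one: "eps F2 = -1"
  by (simp add: eps_F2)

lemmas pluecker_relations_F1pm = pluecker_relations_conv_gp_terms[of F1pm, OF _ _ eps_F1pm]
lemmas pluecker_relations_sign_hyperfield =
  pluecker_relations_conv_gp_terms[of sign_hyperfield, OF _ _ eps_sign_hyperfield]
lemmas pluecker_relations_F2 = pluecker_relations_conv_gp_terms[of F2, OF _ _ eps_F2_minus_one]

lemma gp_terms_signed:
  assumes "ys \<in> tuples E (Suc w)" "set xs \<subseteq> E" "Suc (length xs) = r"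
    and \<nu>: "\<And>zs. zs \<in> tuples E w \<Longrightarrow> \<nu> zs \<in> {0, 1, -1::int}"
    and \<mu>: "\<And>zs. zs \<in> tuples E r \<Longrightarrow> \<mu> zs \<in> {0, 1, -1}"
  shows "set_mset (gp_terms \<nu> \<mu> ys xs) \<subseteq> {0, 1, -1}"
proof
  fix t assume "t \<in># gp_terms \<nu> \<mu> ys xs"
  then obtain k where k: "k \<le> w" and t: "t = (-1) ^ Suc k * \<nu> (omit k ys) * \<mu> (ys ! k # xs)"
    using assms(1) unfolding gp_terms_def tuples_def by (auto simp: less_Suc_eq_le simp del: power_Suc)
  have "\<nu> (omit k ys) \<in> {0, 1, -1}" "\<mu> (ys ! k # xs) \<in> {0, 1, -1}"
    using k assms(1-3) by (auto intro!: \<nu> \<mu> omit_in_tuples nth_Cons_in_tuples simp del: insert_iff)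
  moreover have "(-1::int) ^ Suc k \<in> {1, -1}" by (simp add: minus_one_power_iff)
  ultimately show "t \<in> {0, 1, -1}" unfolding t by auto
qed

lemma gp_terms_of_int:
  assumes "ys \<in> tuples E (Suc w)" "set xs \<subseteq> E" "Suc (length xs) = r"
    and \<nu>: "\<And>zs. zs \<in> tuples E w \<Longrightarrow> \<nu>' zs = of_int (\<nu> zs)"
    and \<mu>: "\<And>zs. zs \<in> tuples E r \<Longrightarrow> \<mu>' zs = of_int (\<mu> zs)"
  shows "gp_terms \<nu>' \<mu>' ys xs = image_mset of_int (gp_terms \<nu> \<mu> ys xs)"
proof -
  have "\<nu>' (omit k ys) = of_int (\<nu> (omit k ys))" "\<mu>' (ys ! k # xs) = of_int (\<mu> (ys ! k # xs))"
    if "k < length ys" for k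
  proof -
    have "k \<le> w" using that assms(1) by (simp add: tuples_def)
    then show "\<nu>' (omit k ys) = of_int (\<nu> (omit k ys))" "\<mu>' (ys ! k # xs) = of_int (\<mu> (ys ! k # xs))"
      using assms(1-3) omit_in_tuples nth_Cons_in_tuples[of ys E "Suc w" k xs r] by (auto intro!: \<nu> \<mu>)
  qed
  then show ?thesis unfolding gp_terms_def mset_map multiset.map_comp
    by (intro image_mset_cong) (simp add: o_def)
qed

lemma of_int_sum_mset: "of_int (sum_mset S) = sum_mset (image_mset of_int S)"
  by (induction S) simp_all

lemma of_int_bit_eq_0_iff: "of_int a = (0::bit) \<longleftrightarrow> even a"
proof (cases "even a")
  case False
  then obtain b where "a = 2 * b + 1" by (rule oddE)
  then show ?thesis by simp
qed (auto elim!: evenE)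

text \<open>The sign relation says that both signs occur or neither does. The relation over
  \<open>F2\<close> is the same sum modulo 2 and gives the parity.\<close>

lemma weak_gp_of_sign_hyperfield_F2:
  assumes S: "pluecker_relations sign_hyperfield E w \<nu> r \<mu>" and F2: "pluecker_relations F2 E w \<nu>2 r \<mu>2"
    and \<nu>: "\<And>zs. zs \<in> tuples E w \<Longrightarrow> \<nu> zs \<in> {0, 1, -1}" "\<And>zs. zs \<in> tuples E w \<Longrightarrow> \<nu>2 zs = of_int (\<nu> zs)"
    and \<mu>: "\<And>zs. zs \<in> tuples E r \<Longrightarrow> \<mu> zs \<in> {0, 1, -1}" "\<And>zs. zs \<in> tuples E r \<Longrightarrow> \<mu>2 zs = of_int (\<mu> zs)"
  shows "weak_gp E w \<nu> r \<mu>"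
  unfolding weak_gp_def
proof (intro ballI allI impI weakly_null_signs)
  fix ys xs assume ys: "ys \<in> tuples E (Suc w)" and xs: "set xs \<subseteq> E \<and> Suc (length xs) = r"
  show "set_mset (gp_terms \<nu> \<mu> ys xs) \<subseteq> {0, 1, -1}"
    using ys xs \<nu>(1) \<mu>(1) by (intro gp_terms_signed) auto
  show "null_sum sign_hyperfield (gp_terms \<nu> \<mu> ys xs)"
    using S ys xs by (subst (asm) pluecker_relations_sign_hyperfield) (simp_all add: sign_hyperfield_def)
  have "null_sum F2 (gp_terms \<nu>2 \<mu>2 ys xs)"
    using F2 ys xs by (subst (asm) pluecker_relations_F2) (simp_all add: F2_def)
  moreover have "gp_terms \<nu>2 \<mu>2 ys xs = image_mset of_int (gp_terms \<nu> \<mu> ys xs)"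
    using ys xs \<nu>(2) \<mu>(2) by (intro gp_terms_of_int) auto
  ultimately have "of_int (sum_mset (gp_terms \<nu> \<mu> ys xs)) = (0::bit)"
    by (simp add: null_sum_F2_iff of_int_sum_mset)
  then show "even (sum_mset (gp_terms \<nu> \<mu> ys xs))" by (simp only: of_int_bit_eq_0_iff)
qed

lemma gp_functions_sign_hyperfield:
  assumes "\<phi> \<in> gp_functions sign_hyperfield E r"
  shows "\<And>xs. xs \<in> tuples E r \<Longrightarrow> \<phi> xs \<in> {0, 1, -1}" "alternating E r \<phi>"
    "pluecker_relations sign_hyperfield E r \<phi> r \<phi>"
proof -
  have S: "tzero sign_hyperfield = 0" "monoid.mult sign_hyperfield = (*)" "carrier sign_hyperfield = {0, 1, -1}"
    by (simp_all add: sign_hyperfield_def)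
  show "\<And>xs. xs \<in> tuples E r \<Longrightarrow> \<phi> xs \<in> {0, 1, -1}"
    using gp_functions_carrier[OF assms] unfolding S .
  show "alternating E r \<phi>" "pluecker_relations sign_hyperfield E r \<phi> r \<phi>"
    using assms unfolding gp_functions_def alternating_def eps_sign_hyperfield S by simp_all
qed

text \<open>The two tracts have the same elements, product and \<open>eps\<close> and differ only in
  their nullsets, so only the Pluecker relations have to be supplied.\<close>

lemma gp_functions_F1pm_of_sign_hyperfield:
  assumes "\<phi> \<in> gp_functions sign_hyperfield E r" "pluecker_relations F1pm E r \<phi> r \<phi>"
  shows "\<phi> \<in> gp_functions F1pm E r"
proof -
  have "tzero sign_hyperfield = tzero F1pm" "monoid.mult sign_hyperfield = monoid.mult F1pm"
    "carrier sign_hyperfield = carrier F1pm"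
    by (simp_all add: sign_hyperfield_def F1pm_def)
  then show ?thesis
    using assms unfolding gp_functions_def eps_sign_hyperfield eps_F1pm by simp
qed

lemma strong_gp_imp_pluecker_relations_F1pm:
  assumes "strong_gp E w \<nu> r \<mu>"
    and "\<And>zs. zs \<in> tuples E w \<Longrightarrow> \<nu> zs \<in> {0, 1, -1}" "\<And>zs. zs \<in> tuples E r \<Longrightarrow> \<mu> zs \<in> {0, 1, -1}"
  shows "pluecker_relations F1pm E w \<nu> r \<mu>"
proof (subst pluecker_relations_F1pm)
  show "\<forall>ys\<in>tuples E (Suc w). \<forall>xs. set xs \<subseteq> E \<and> Suc (length xs) = r \<longrightarrow> null_sum F1pm (gp_terms \<nu> \<mu> ys xs)"
  proof (intro ballI allI impI)
    fix ys xs assume *: "ys \<in> tuples E (Suc w)" "set xs \<subseteq> E \<and> Suc (length xs) = r"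
    then have "set_mset (gp_terms \<nu> \<mu> ys xs) \<subseteq> {0, 1, -1}"
      using assms(2,3) by (intro gp_terms_signed) auto
    then show "null_sum F1pm (gp_terms \<nu> \<mu> ys xs)"
      using assms(1) * by (simp add: null_sum_F1pm_iff strong_gp_def gp_sum_conv_terms)
  qed
qed (simp_all add: F1pm_def)

text \<open>An element of \<open>F2\<close> is determined by whether it vanishes, and 1 and -1 both
  reduce to 1.\<close>

lemma gp_support_eq_imp_of_int:
  assumes "gp_support F2 E r \<phi>2 = gp_support sign_hyperfield E r \<phi>"
    and "\<And>xs. xs \<in> tuples E r \<Longrightarrow> \<phi> xs \<in> {0, 1, -1}" "xs \<in> tuples E r"
  shows "\<phi>2 xs = of_int (\<phi> xs)"
proof -
  have "\<phi>2 xs = 0 \<longleftrightarrow> \<phi> xs = 0"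
    using fun_cong[OF assms(1), of xs] assms(3)
    by (simp add: gp_support_def to_krasner_def sign_hyperfield_def F2_def split: if_splits)
  then show ?thesis using assms(2)[OF assms(3)] by (cases "\<phi>2 xs") auto
qed

theorem binary_orientable_imp_regular:
  assumes rank: "flag_rank M = [r, r + 1]" and bin: "binary_flag E M" and ori: "orientable_flag E M"
  shows "regular_flag E M"
proof -
  obtain \<mu>2 \<nu>2 where F2: "\<mu>2 \<in> gp_functions F2 E r" "\<nu>2 \<in> gp_functions F2 E (Suc r)"
    "pluecker_relations F2 E (Suc r) \<nu>2 r \<mu>2"
    and M2: "M = [\<lparr>mrank = r, mclass = {gp_support F2 E r \<mu>2}\<rparr>,
      \<lparr>mrank = Suc r, mclass = {gp_support F2 E (Suc r) \<nu>2}\<rparr>]"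
    using bin unfolding binary_flag_def tract.flag_lift_iff[OF tract_F2 rank] by auto
  obtain \<mu> \<nu> where S: "\<mu> \<in> gp_functions sign_hyperfield E r" "\<nu> \<in> gp_functions sign_hyperfield E (Suc r)"
    "pluecker_relations sign_hyperfield E (Suc r) \<nu> r \<mu>"
    and MS: "M = [\<lparr>mrank = r, mclass = {gp_support sign_hyperfield E r \<mu>}\<rparr>,
      \<lparr>mrank = Suc r, mclass = {gp_support sign_hyperfield E (Suc r) \<nu>}\<rparr>]"
    using ori unfolding orientable_flag_def tract.flag_lift_iff[OF tract_sign_hyperfield rank] by auto
  note \<mu> = gp_functions_sign_hyperfield[OF S(1)] and \<nu> = gp_functions_sign_hyperfield[OF S(2)]
  \<comment> \<open>Both lifts have the supports recorded in \<open>M\<close>, so the binary one is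
    the orientation modulo 2.\<close>
  have \<mu>2: "\<And>xs. xs \<in> tuples E r \<Longrightarrow> \<mu>2 xs = of_int (\<mu> xs)"
    using M2 MS \<mu>(1) by (intro gp_support_eq_imp_of_int[of E r]) auto
  have \<nu>2: "\<And>xs. xs \<in> tuples E (Suc r) \<Longrightarrow> \<nu>2 xs = of_int (\<nu> xs)"
    using M2 MS \<nu>(1) by (intro gp_support_eq_imp_of_int[of E "Suc r"]) auto
  have "pluecker_relations F2 E r \<mu>2 r \<mu>2" "pluecker_relations F2 E (Suc r) \<nu>2 (Suc r) \<nu>2"
    using F2 by (auto simp: gp_functions_def)
  then have pair: "weak_gp_pair E r \<nu> \<mu>"
    unfolding weak_gp_pair_def using \<mu> \<nu> \<mu>2 \<nu>2 S(3) F2(3)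
    by (intro conjI) (blast intro: weak_gp_of_sign_hyperfield_F2)+
  obtain B where B: "B \<in> tuples E (Suc r)" "\<nu> B \<noteq> 0"
    using S(2) by (auto simp: gp_functions_def sign_hyperfield_def)
  have "\<nu> B * \<nu> B = 1" using \<nu>(1)[OF B(1)] B(2) by auto
  note strong = weak_gp_pair_imp_strong_gp[OF pair B(1) this]
  have rel: "pluecker_relations F1pm E (Suc r) \<nu> (Suc r) \<nu>" "pluecker_relations F1pm E r \<mu> r \<mu>"
    "pluecker_relations F1pm E (Suc r) \<nu> r \<mu>"
    using strong[THEN strong_gp_imp_pluecker_relations_F1pm] \<mu>(1) \<nu>(1) by blast+
  \<comment> \<open>The orientation itself is the regular lift; supports depend only on the zero
    element, which both tracts share.\<close>
  have "gp_support F1pm E m \<phi> = gp_support sign_hyperfield E m \<phi>" for m \<phi>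
    by (simp add: gp_support_def to_krasner_def F1pm_def sign_hyperfield_def)
  then show ?thesis
    unfolding regular_flag_def tract.flag_lift_iff[OF tract_F1pm rank]
    using S(1,2) rel MS
    by (intro bexI[of _ \<mu>] bexI[of _ \<nu>] conjI gp_functions_F1pm_of_sign_hyperfield) simp_all
qed

theorem theoremF:
  fixes n r :: nat and M :: "(nat, nat) coeff_matroid list"
  assumes "flag_matroid krasner {1..n} M"
    and "flag_rank M = [r, r + 1]"
  shows "regular_flag {1..n} M \<longleftrightarrow> binary_flag {1..n} M \<and> orientable_flag {1..n} M"
proof
  assume "regular_flag {1..n} M"
  then show "binary_flag {1..n} M \<and> orientable_flag {1..n} M"
    unfolding regular_flag_def binary_flag_def orientable_flag_def
    using tract_morphism.flag_lift_image[OF tract_morphism_F1pm_F2 assms(2)]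
      tract_morphism.flag_lift_image[OF tract_morphism_F1pm_sign_hyperfield assms(2)] by blast
next
  assume "binary_flag {1..n} M \<and> orientable_flag {1..n} M"
  then show "regular_flag {1..n} M" using binary_orientable_imp_regular[OF assms(2)] by blast
qed

end
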